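(* Let $g\in\mathcal{G}$ and let $G(t)=\int_0^t g(s)\,ds$ be its primitive, satisfying, for some $\alpha\ge0$, $$\lim_{t\to\infty}\frac{G(t^\lambda)}{G(t)}=\lambda^\alpha\quad\text{for all }\lambda>0.$$ Suppose in addition that the function $t\mapsto tg(t)$ is eventually monotone. Let $\gamma\in EL(0,\infty)$ and let $B_{\gamma,g}:=\frac{\log 2}{\Gamma(\alpha+1)}\,\zeta_\gamma\circ D_g$. Then $$B_{\gamma,g}(x)=\frac{\log2}{\Gamma(\alpha+1)}\,\gamma\Big(t\mapsto\frac{1}{G(e^t)}\sum_{n=0}^\infty x_n2^{-n/t}2^ng(2^n)\Big),\quad x\in\ell_\infty.$$
   Context: $H$ is a complex separable infinite-dimensional Hilbert space with a fixed orthonormal basis $\{e_n\}_{n\ge0}$; $\mathcal{C}_0(H)$ are the compact operators on $H$; $\mathrm{Tr}$ is the standard trace; $\Gamma$ is the Gamma function; $\mu(n,T)$, $n\ge0$, are the singular values of $T\in\mathcal{C}_0(H)$ in non-increasing order. $\mathcal{G}$ is the set of all decreasing functions $g:[0,\infty)\to(0,\infty)$ vanishing at $+\infty$ with $g\notin L_1(0,\infty)$ and $\lim_{t\to\infty}\frac{g(2t)}{g(t)}=\frac12$. For $g\in\mathcal{G}$, $\mathcal{I}_g:=\{T\in\mathcal{C}_0(H):\mu(n,T)=O(g(n))\}$. $\ell_\infty$ is the space of bounded real sequences. $D_g:\ell_\infty\to\mathcal{I}_g$ is $D_g(x)=\mathrm{diag}\big(x_0g(2^0),x_1g(2^1),x_1g(2^1),\dots,\underbrace{x_ng(2^n),\dots,x_ng(2^n)}_{2^n\text{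 times}},\dots\big)$ (diagonal operator in the basis $\{e_n\}$). $EL(0,\infty)$ is the set of positive linear functionals $\gamma$ on real $L_\infty(0,\infty)$ with $\gamma(f)=\mathrm{ess}\lim_{t\to\infty}f(t)$ whenever this limit exists. If $f$ is measurable and bounded on $(t_0,\infty)$ for some $t_0>0$, then $\gamma(f):=\gamma(f\chi_{(t_0,\infty)})$. Extended zeta-function residue: with $\mathcal{Z}_G:=\{T\in\mathcal{C}_0(H):\limsup_{t\to\infty}\frac{1}{G(e^t)}\mathrm{Tr}(|T|^{1+1/t})<\infty\}$, set $\zeta_\gamma(T):=\gamma\big(t\mapsto\frac{1}{G(e^t)}\mathrm{Tr}(T^{1+1/t})\big)$ for $0\le T\in\mathcal{Z}_G$, extended linearly by $\zeta_\gamma(T)=\zeta_\gamma((\Re T)_+)-\zeta_\gamma((\Re T)_-)+i\zeta_\gamma((\Im T)_+)-i\zeta_\gamma((\Im T)_-)$. Under the hypotheses of the statement $\mathcal{I}_g\subset\mathcal{Z}_G$, so $\zeta_\gamma$ is defined on $\mathcal{I}_g$ (and $B_{\gamma,g}$ is a Banach limit, i.e. a positive shift-invariant functional extending the usual limit). *)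

theory Defs
  imports "HOL-Analysis.Analysis"
begin

section \<open>Complex Hilbert spaces with an orthonormal basis\<close>

text \<open>
  The inner product is linear in the second argument. Its positive definiteness is contained
  in the last axiom, because \<^term>\<open>norm x\<close> is positive for nonzero \<^term>\<open>x\<close> and the real
  square root has the sign of its argument.
\<close>

class complex_inner = real_normed_vector +
  fixes scaleC :: "complex \<Rightarrow> 'a \<Rightarrow> 'a" (infixr "*\<^sub>C" 75)
    and cinner :: "'a \<Rightarrow> 'a \<Rightarrow> complex"
  assumes scaleC_add_right: "a *\<^sub>C (x + y) = a *\<^sub>C x + a *\<^sub>C y"
    and scaleC_add_left: "(a + b) *\<^sub>C x = a *\<^sub>C x + b *\<^sub>C x"
    and scaleC_scaleC: "a *\<^sub>C (b *\<^sub>C x) = (a * b) *\<^sub>C x"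
    and scaleR_scaleC: "r *\<^sub>R x = complex_of_real r *\<^sub>C x"
    and cinner_commute: "cinner x y = cnj (cinner y x)"
    and cinner_add_right: "cinner x (y + z) = cinner x y + cinner x z"
    and cinner_scaleC_right: "cinner x (a *\<^sub>C y) = a * cinner x y"
    and norm_eq_sqrt_cinner: "norm x = sqrt (Re (cinner x x))"

class chilbert_space = complex_inner + complete_space

text \<open>
  A space with such a sequence is automatically separable and infinite-dimensional.
\<close>

definition orthonormal_basis :: "(nat \<Rightarrow> 'h::chilbert_space) \<Rightarrow> bool" where
  "orthonormal_basis e \<longleftrightarrow>
     (\<forall>m n. cinner (e m) (e n) = (if m = n then 1 else 0)) \<and>
     closure {(\<Sum>n<N. c n *\<^sub>C e n) | (N::nat) (c::nat \<Rightarrow> complex). True} = UNIV"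


section \<open>Operators\<close>

definition bounded_clinear :: "('h::chilbert_space \<Rightarrow> 'h) \<Rightarrow> bool" where
  "bounded_clinear T \<longleftrightarrow> bounded_linear T \<and> (\<forall>c v. T (c *\<^sub>C v) = c *\<^sub>C T v)"

definition compact_op :: "('h::chilbert_space \<Rightarrow> 'h) \<Rightarrow> bool" where
  "compact_op T \<longleftrightarrow> bounded_clinear T \<and> compact (closure (T ` cball 0 1))"

definition adj :: "('h::chilbert_space \<Rightarrow> 'h) \<Rightarrow> ('h \<Rightarrow> 'h)" where
  "adj T = (THE S. \<forall>u v. cinner u (T v) = cinner (S u) v)"

text \<open>
  Functional calculus \<open>f(A)\<close> for a compact self-adjoint operator \<open>A\<close>, with \<open>f\<close> continuous on
  the spectrum: it acts as \<open>f s\<close> on the eigenspace of each eigenvalue \<open>s\<close>. By the spectral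
  theorem the eigenvectors of \<open>A\<close> (including those for \<open>s = 0\<close>) span a dense subspace, so
  this determines the bounded operator \<open>f(A)\<close>.
\<close>

definition fun_calc :: "(real \<Rightarrow> real) \<Rightarrow> ('h::chilbert_space \<Rightarrow> 'h) \<Rightarrow> ('h \<Rightarrow> 'h)" where
  "fun_calc f A =
     (THE B. bounded_clinear B \<and> (\<forall>s v. A v = s *\<^sub>R v \<longrightarrow> B v = f s *\<^sub>R v))"

definition abs_op :: "('h::chilbert_space \<Rightarrow> 'h) \<Rightarrow> ('h \<Rightarrow> 'h)" where
  "abs_op T = fun_calc sqrt (adj T \<circ> T)"

definition powr_op :: "('h::chilbert_space \<Rightarrow> 'h) \<Rightarrow> real \<Rightarrow> ('h \<Rightarrow> 'h)" where
  "powr_op A p = fun_calc (\<lambda>s. s powr p) A"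

definition pos_part :: "('h::chilbert_space \<Rightarrow> 'h) \<Rightarrow> ('h \<Rightarrow> 'h)" where
  "pos_part A = fun_calc (\<lambda>s. max s 0) A"

definition neg_part :: "('h::chilbert_space \<Rightarrow> 'h) \<Rightarrow> ('h \<Rightarrow> 'h)" where
  "neg_part A = fun_calc (\<lambda>s. max (- s) 0) A"

definition Re_op :: "('h::chilbert_space \<Rightarrow> 'h) \<Rightarrow> ('h \<Rightarrow> 'h)" where
  "Re_op T = (\<lambda>v. (1 / 2) *\<^sub>C (T v + adj T v))"

definition Im_op :: "('h::chilbert_space \<Rightarrow> 'h) \<Rightarrow> ('h \<Rightarrow> 'h)" where
  "Im_op T = (\<lambda>v. (1 / (2 * \<i>)) *\<^sub>C (T v - adj T v))"

text \<open>
  The standard trace, on positive operators only, with values in \<open>[0,\<infinity>]\<close>.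
\<close>

definition Tr :: "(nat \<Rightarrow> 'h::chilbert_space) \<Rightarrow> ('h \<Rightarrow> 'h) \<Rightarrow> ennreal" where
  "Tr e A = (\<Sum>n. ennreal (Re (cinner (e n) (A (e n)))))"

definition diag_op :: "(nat \<Rightarrow> 'h::chilbert_space) \<Rightarrow> (nat \<Rightarrow> real) \<Rightarrow> ('h \<Rightarrow> 'h)" where
  "diag_op e d = (\<lambda>v. \<Sum>k. (complex_of_real (d k) * cinner (e k) v) *\<^sub>C e k)"


section \<open>The functions g and the map D\<close>

text \<open>Only the values of \<open>g\<close> on \<open>[0,\<infinity>)\<close> matter.\<close>

definition class_G :: "(real \<Rightarrow> real) set" where
  "class_G = {g. antimono_on {0..} g \<and> (\<forall>t\<ge>0. g t > 0) \<and> (g \<longlongrightarrow> 0) at_top \<and>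
     \<not> integrable (lebesgue_on {0<..}) g \<and>
     ((\<lambda>t. g (2 * t) / g t) \<longlongrightarrow> 1 / 2) at_top}"

definition primitive :: "(real \<Rightarrow> real) \<Rightarrow> real \<Rightarrow> real" where
  "primitive g t = integral {0..t} g"

definition eventually_monotone :: "(real \<Rightarrow> real) \<Rightarrow> bool" where
  "eventually_monotone h \<longleftrightarrow> (\<exists>a. mono_on {a..} h \<or> antimono_on {a..} h)"

text \<open>
  The position \<open>k\<close> of the diagonal carries \<open>x\<^sub>n g(2\<^sup>n)\<close> for the \<open>n\<close> with
  \<open>2\<^sup>n \<le> k + 1 < 2\<^sup>n\<^sup>+\<^sup>1\<close>.
\<close>

definition dyadic_level :: "nat \<Rightarrow> nat" where
  "dyadic_level k = nat \<lfloor>log 2 (real (k + 1))\<rfloor>"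

definition D_op :: "(nat \<Rightarrow> 'h::chilbert_space) \<Rightarrow> (real \<Rightarrow> real) \<Rightarrow> (nat \<Rightarrow> real) \<Rightarrow> ('h \<Rightarrow> 'h)" where
  "D_op e g x = diag_op e (\<lambda>k. x (dyadic_level k) * g (2 ^ dyadic_level k))"


section \<open>Extended limits\<close>

text \<open>
  An element of \<open>L\<^sub>\<infinity>(0,\<infinity>)\<close> is represented by functions on the reals whose values outside
  \<open>(0,\<infinity>)\<close> are irrelevant; a functional on \<open>L\<^sub>\<infinity>(0,\<infinity>)\<close> is a map on such functions that
  respects equality almost everywhere.
\<close>

definition Linf :: "(real \<Rightarrow> real) set" where
  "Linf = {f. f \<in> borel_measurable (lebesgue_on {0<..}) \<and>
     (\<exists>C. AE t in lebesgue_on {0<..}. \<bar>f t\<bar> \<le> C)}"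

definition has_ess_lim :: "(real \<Rightarrow> real) \<Rightarrow> real \<Rightarrow> bool" where
  "has_ess_lim f c \<longleftrightarrow>
     (\<forall>\<epsilon>>0. \<exists>t0. AE t in lebesgue_on {0<..}. t > t0 \<longrightarrow> \<bar>f t - c\<bar> < \<epsilon>)"

definition EL :: "((real \<Rightarrow> real) \<Rightarrow> real) set" where
  "EL = {\<gamma>.
     (\<forall>f\<in>Linf. \<forall>h\<in>Linf. (AE t in lebesgue_on {0<..}. f t = h t) \<longrightarrow> \<gamma> f = \<gamma> h) \<and>
     (\<forall>f\<in>Linf. \<forall>h\<in>Linf. \<gamma> (\<lambda>t. f t + h t) = \<gamma> f + \<gamma> h) \<and>
     (\<forall>a. \<forall>f\<in>Linf. \<gamma> (\<lambda>t. a * f t) = a * \<gamma> f) \<and>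
     (\<forall>f\<in>Linf. (AE t in lebesgue_on {0<..}. 0 \<le> f t) \<longrightarrow> 0 \<le> \<gamma> f) \<and>
     (\<forall>f\<in>Linf. \<forall>c. has_ess_lim f c \<longrightarrow> \<gamma> f = c)}"

text \<open>
  Application of an extended limit to a function that is measurable and bounded on some
  \<open>(t\<^sub>0,\<infinity>)\<close>. The choice of \<open>t\<^sub>0\<close> does not matter, since functions with bounded support are
  annihilated.
\<close>

definition EL_apply :: "((real \<Rightarrow> real) \<Rightarrow> real) \<Rightarrow> (real \<Rightarrow> real) \<Rightarrow> real" where
  "EL_apply \<gamma> f =
     (let t0 = (SOME t0. t0 > 0 \<and> f \<in> borel_measurable (lebesgue_on {t0<..}) \<and>
                  bounded (f ` {t0<..}))
      in \<gamma> (\<lambda>t. f t * indicator {t0<..} t))"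


section \<open>The extended zeta-function residue\<close>

definition class_Z :: "(nat \<Rightarrow> 'h::chilbert_space) \<Rightarrow> (real \<Rightarrow> real) \<Rightarrow> ('h \<Rightarrow> 'h) set" where
  "class_Z e G = {T. compact_op T \<and>
     Limsup at_top (\<lambda>t. Tr e (powr_op (abs_op T) (1 + 1 / t)) / ennreal (G (exp t))) < \<infinity>}"

text \<open>
  For operators in \<^const>\<open>class_Z\<close> the trace below is finite for all large \<open>t\<close>, so the
  value of \<^const>\<open>enn2real\<close> at infinity plays no role.
\<close>

definition zeta_pos ::
  "((real \<Rightarrow> real) \<Rightarrow> real) \<Rightarrow> (nat \<Rightarrow> 'h::chilbert_space) \<Rightarrow> (real \<Rightarrow> real) \<Rightarrow> ('h \<Rightarrow> 'h) \<Rightarrow> real" where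
  "zeta_pos \<gamma> e G T =
     EL_apply \<gamma> (\<lambda>t. 1 / G (exp t) * enn2real (Tr e (powr_op T (1 + 1 / t))))"

text \<open>The residue is left unspecified outside its domain \<^const>\<open>class_Z\<close>.\<close>

definition zeta ::
  "((real \<Rightarrow> real) \<Rightarrow> real) \<Rightarrow> (nat \<Rightarrow> 'h::chilbert_space) \<Rightarrow> (real \<Rightarrow> real) \<Rightarrow> ('h \<Rightarrow> 'h) \<Rightarrow> complex" where
  "zeta \<gamma> e G T =
     (if T \<in> class_Z e G then
        complex_of_real (zeta_pos \<gamma> e G (pos_part (Re_op T)))
        - complex_of_real (zeta_pos \<gamma> e G (neg_part (Re_op T)))
        + \<i> * complex_of_real (zeta_pos \<gamma> e G (pos_part (Im_op T)))
        - \<i> * complex_of_real (zeta_pos \<gamma> e G (neg_part (Im_op T)))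
      else undefined)"

definition B_functional ::
  "((real \<Rightarrow> real) \<Rightarrow> real) \<Rightarrow> (nat \<Rightarrow> 'h::chilbert_space) \<Rightarrow> (real \<Rightarrow> real) \<Rightarrow> real \<Rightarrow> (nat \<Rightarrow> real) \<Rightarrow> complex" where
  "B_functional \<gamma> e g \<alpha> x =
     complex_of_real (ln 2 / Gamma (\<alpha> + 1)) * zeta \<gamma> e (primitive g) (D_op e g x)"

end

theory Submission
  imports Defs
begin

text \<open>
  Everything in sight is diagonal in the basis \<open>e\<close>. On a diagonal operator the functional calculus,
  the adjoint and the trace act entry by entry, so that for a nonnegative bounded sequence \<open>y\<close> the
  trace of \<open>D(y)^(1+1/t)\<close> is the sum of the \<open>(y\<^sub>n g(2\<^sup>n))^(1+1/t)\<close>, each taken \<open>2\<^sup>n\<close> times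
  (\<open>Tr_powr_op_D_op\<close>). Splitting \<open>x\<close> into its positive and negative part reduces the claim to such \<open>y\<close>.

  Put \<open>mass n = 2\<^sup>n g(2\<^sup>n)\<close> and \<open>phi t = G(e\<^sup>t)\<close>. The \<open>n\<close>-th term of the trace is
  \<open>y\<^sub>n^(1+1/t) mass(n)^(1/t)\<close> times \<open>2^(-n/t) mass(n)\<close>, while the series in the theorem has \<open>y\<^sub>n\<close> in place of
  the first factor. For large \<open>t\<close> the exchange is harmless: \<open>y^(1+1/t)\<close> tends to \<open>y\<close> uniformly for \<open>y\<close> in a
  bounded interval, and since \<open>g(2t)/g(t)\<close> tends to \<open>1/2\<close>, consecutive masses have ratio tending to
  \<open>1\<close>, so that \<open>ln mass(n) = o(n)\<close> (\<open>ln_mass_sublinear\<close>) and \<open>mass(n)^(1/t)\<close> is close to \<open>1\<close> as long as \<open>n\<close>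
  is of order \<open>t\<close>; beyond that a part of the decay of \<open>2^(-n/t)\<close> absorbs it. The outcome is that the two
  terms differ by at most \<open>\<eta> mass(n) e^(-n/4t)\<close> for any given \<open>\<eta> > 0\<close> and all large \<open>t\<close>
  (\<open>trace_term_approx\<close>).

  It remains to see that the sum of \<open>mass(n) e^(-n/4t)\<close> over \<open>n\<close> is \<open>O(phi t)\<close> (\<open>sum_mass_exp_le_phi\<close>). Comparing
  \<open>g\<close> with its dyadic samples bounds the sum of the masses up to \<open>s\<close> by \<open>2 phi s\<close>, and the hypothesis
  on \<open>G\<close> with exponent \<open>2\<close> gives \<open>phi(2t) \<le> c phi(t)\<close>, that is, at most polynomial growth of \<open>phi\<close>, which the
  exponential beats. Hence the normalized trace and the normalized series are bounded for large \<open>t\<close>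
  and differ by a null function, and an extended limit does not distinguish them.
\<close>

section \<open>Complex inner product spaces\<close>

instance chilbert_space \<subseteq> banach ..

lemma cinner_add_left: "cinner (x + y) z = cinner x z + cinner y (z::'h::complex_inner)"
  by (metis cinner_add_right cinner_commute complex_cnj_add)

lemma cinner_scaleC_left: "cinner (a *\<^sub>C x) y = cnj a * cinner x (y::'h::complex_inner)"
  by (metis cinner_commute cinner_scaleC_right complex_cnj_mult)

lemma cinner_scaleR_right: "cinner x (r *\<^sub>R y) = r *\<^sub>R cinner x (y::'h::complex_inner)"
  by (simp add: scaleR_scaleC cinner_scaleC_right scaleR_conv_of_real)

lemma cinner_self: "cinner x x = complex_of_real ((norm (x::'h::complex_inner))\<^sup>2)"
proof -
  have im: "Im (cinner x x) = 0"
    by (metis cinner_commute complex_cnj_cancel_iff cnj.simps(2) add.inverse_neutral neg_equal_zero)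
  have "0 \<le> sqrt (Re (cinner x x))"
    by (metis norm_eq_sqrt_cinner norm_ge_zero)
  then have "(norm x)\<^sup>2 = Re (cinner x x)"
    by (simp add: norm_eq_sqrt_cinner)
  with im show ?thesis
    by (simp add: complex_eq_iff)
qed

lemma norm_scaleC: "norm (c *\<^sub>C x) = cmod c * norm (x::'h::complex_inner)"
proof -
  have "complex_of_real ((norm (c *\<^sub>C x))\<^sup>2) = complex_of_real ((cmod c * norm x)\<^sup>2)"
    unfolding cinner_self[symmetric] cinner_scaleC_left cinner_scaleC_right
    by (auto simp add: cinner_self power_mult_distrib complex_norm_square mult.commute simp flip: of_real_power)
  then show ?thesis
    by (metis of_real_eq_iff norm_ge_zero power2_eq_iff_nonneg zero_le_mult_iff)
qed

lemma scaleC_zero_left [simp]: "0 *\<^sub>C (x::'h::complex_inner) = 0"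
  by (metis norm_scaleC norm_zero mult_zero_left norm_eq_zero)

lemma scaleC_zero_right [simp]: "c *\<^sub>C (0::'h::complex_inner) = 0"
  by (metis norm_scaleC norm_zero mult_zero_right norm_eq_zero)

lemma scaleC_one [simp]: "1 *\<^sub>C (x::'h::complex_inner) = x"
  by (metis scaleR_scaleC scaleR_one of_real_1)

lemma scaleR_scaleC_commute: "r *\<^sub>R (c *\<^sub>C x) = c *\<^sub>C (r *\<^sub>R (x::'h::complex_inner))"
  by (simp add: scaleR_scaleC scaleC_scaleC mult.commute)

text \<open>
  The norm is given to satisfy the triangle inequality, and expanding the square of \<open>\<parallel>x + y\<parallel>\<close> turns that
  into the inequality for the real part; rotating \<open>y\<close> by a phase makes the inner product real.
\<close>
lemma Cauchy_Schwarz_cinner: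
  "cmod (cinner x y) \<le> norm x * norm (y::'h::complex_inner)"
proof -
  have real: "Re (cinner x y) \<le> norm x * norm y" for x y :: 'h
  proof -
    have "cinner (x + y) (x + y) = cinner x x + cinner y y + (cinner x y + cnj (cinner x y))"
      by (simp add: cinner_add_left cinner_add_right cinner_commute[of y x])
    then have "Re (cinner (x + y) (x + y)) = Re (cinner x x) + Re (cinner y y) + 2 * Re (cinner x y)"
      by simp
    then have "(norm (x + y))\<^sup>2 = (norm x)\<^sup>2 + (norm y)\<^sup>2 + 2 * Re (cinner x y)"
      by (simp add: cinner_self)
    moreover have "(norm (x + y))\<^sup>2 \<le> (norm x + norm y)\<^sup>2"
      by (intro power_mono norm_triangle_ineq) simp
    ultimately show ?thesis
      by (simp add: power2_sum)
  qed
  show ?thesis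
  proof (cases "cinner x y = 0")
    case False
    define c where "c = cnj (cinner x y) / cmod (cinner x y)"
    have c: "cmod c = 1"
      using False by (simp add: c_def norm_divide)
    have "c * cinner x y = complex_of_real (cmod (cinner x y))"
      using False
      by (simp add: c_def complex_norm_square[symmetric] power2_eq_square mult.commute)
    then have "cmod (cinner x y) = Re (cinner x (c *\<^sub>C y))"
      by (simp add: cinner_scaleC_right)
    also have "\<dots> \<le> norm x * norm (c *\<^sub>C y)"
      by (rule real)
    finally show ?thesis
      by (simp add: norm_scaleC c)
  qed simp
qed

lemma bounded_linear_cinner_right: "bounded_linear (cinner (u::'h::complex_inner))"
  by (rule bounded_linear_intro[where K = "norm u"])
    (auto simp: cinner_add_right cinner_scaleR_right mult.commute[of _ "norm u"] Cauchy_Schwarz_cinner)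

lemma bounded_linear_scaleC_right: "bounded_linear (\<lambda>v. c *\<^sub>C (v::'h::complex_inner))"
  by (rule bounded_linear_intro[where K = "cmod c"])
    (auto simp: scaleC_add_right scaleR_scaleC_commute norm_scaleC)

lemma bounded_linear_scaleC_left: "bounded_linear (\<lambda>c. c *\<^sub>C (v::'h::complex_inner))"
  by (rule bounded_linear_intro[where K = "norm v"])
    (auto simp: scaleC_add_left scaleR_scaleC scaleC_scaleC norm_scaleC scaleR_conv_of_real)

lemma cinner_eqI:
  assumes "\<And>v. cinner u v = cinner u' (v::'h::complex_inner)"
  shows "u = u'"
proof -
  have "cinner (u - u') (u - u') = 0"
    using assms[of "u - u'"] cinner_add_left[of "u - u'" u' "u - u'"] by simp
  then show ?thesis
    by (simp add: cinner_self)
qed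

section \<open>Diagonal operators\<close>

lemma bounded_range_if_abs_le:
  assumes "bounded (range d)" "\<And>k. \<bar>f k\<bar> \<le> \<bar>d k :: real\<bar>"
  shows "bounded (range f)"
  using assms unfolding bounded_iff by (auto intro: order_trans)

locale onb =
  fixes e :: "nat \<Rightarrow> 'h::chilbert_space"
  assumes orthonormal_basis: "orthonormal_basis e"
begin

lemma cinner_e: "cinner (e m) (e n) = (if m = n then 1 else 0)"
  using orthonormal_basis by (simp add: orthonormal_basis_def)

text \<open>
  For an operator with the basis vectors as eigenvectors, this makes the description in
  \<^const>\<open>fun_calc\<close> unambiguous.
\<close>
lemma bounded_clinear_eqI:
  assumes "bounded_clinear A" "bounded_clinear B" "\<And>n. A (e n) = B (e n)"
  shows "A = B"
proof -
  have A: "bounded_linear A" "\<And>c v. A (c *\<^sub>C v) = c *\<^sub>C A v"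
    and B: "bounded_linear B" "\<And>c v. B (c *\<^sub>C v) = c *\<^sub>C B v"
    using assms by (auto simp: bounded_clinear_def)
  have "closed {v. A v = B v}"
    by (intro closed_Collect_eq linear_continuous_on A B)
  moreover have "{(\<Sum>n<N. c n *\<^sub>C e n) | (N::nat) (c::nat \<Rightarrow> complex). True} \<subseteq> {v. A v = B v}"
    using A B assms(3)
    by (auto simp: linear_sum bounded_linear.linear)
  ultimately have "closure {(\<Sum>n<N. c n *\<^sub>C e n) | (N::nat) (c::nat \<Rightarrow> complex). True} \<subseteq> {v. A v = B v}"
    by (rule closure_minimal[rotated])
  then show ?thesis
    using orthonormal_basis by (auto simp: orthonormal_basis_def)
qed

lemma cinner_e_sum:
  assumes "finite F"
  shows "cinner (e k) (\<Sum>i\<in>F. c i *\<^sub>C e i) = (if k \<in> F then c k else 0)"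
proof -
  have "cinner (e k) (\<Sum>i\<in>F. c i *\<^sub>C e i) = (\<Sum>i\<in>F. c i * (if k = i then 1 else 0))"
    by (simp add: linear_sum bounded_linear.linear[OF bounded_linear_cinner_right]
        cinner_scaleC_right cinner_e)
  also have "\<dots> = (\<Sum>i\<in>F. if i = k then c i else 0)"
    by (rule sum.cong) auto
  finally show ?thesis
    using assms by simp
qed

lemma norm_sum_e:
  assumes "finite F"
  shows "(norm (\<Sum>i\<in>F. c i *\<^sub>C e i))\<^sup>2 = (\<Sum>i\<in>F. (cmod (c i))\<^sup>2)"
  using assms
proof (induction F rule: finite_induct)
  case (insert k F)
  let ?s = "\<Sum>i\<in>F. c i *\<^sub>C e i"
  have 0: "cinner (e k) ?s = 0"
    using insert by (simp add: cinner_e_sum)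
  then have "cinner ?s (e k) = 0"
    by (metis cinner_commute complex_cnj_zero)
  with 0 have "cinner (c k *\<^sub>C e k + ?s) (c k *\<^sub>C e k + ?s) = c k * cnj (c k) + cinner ?s ?s"
    by (simp add: cinner_add_left cinner_add_right cinner_scaleC_left cinner_scaleC_right cinner_e)
  then have "complex_of_real ((norm (c k *\<^sub>C e k + ?s))\<^sup>2) = complex_of_real ((cmod (c k))\<^sup>2 + (norm ?s)\<^sup>2)"
    by (simp only: cinner_self complex_norm_square of_real_add)
  then have "(norm (c k *\<^sub>C e k + ?s))\<^sup>2 = (cmod (c k))\<^sup>2 + (norm ?s)\<^sup>2"
    using of_real_eq_iff by blast
  then show ?case
    using insert by simp
qed simp

text \<open>
  The inner product of \<open>v\<close> with its projection to the span of the \<open>e i\<close> is the squared norm of the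
  projection, so the Cauchy-Schwarz inequality bounds the norm of the projection by that of \<open>v\<close>.
\<close>
lemma Bessel:
  assumes "finite F"
  shows "(\<Sum>i\<in>F. (cmod (cinner (e i) v))\<^sup>2) \<le> (norm v)\<^sup>2"
proof -
  let ?s = "\<Sum>i\<in>F. cinner (e i) v *\<^sub>C e i"
  let ?S = "\<Sum>i\<in>F. (cmod (cinner (e i) v))\<^sup>2"
  have "cinner v ?s = (\<Sum>i\<in>F. cinner (e i) v * cinner v (e i))"
    by (simp add: linear_sum bounded_linear.linear[OF bounded_linear_cinner_right]
        cinner_scaleC_right)
  also have "\<dots> = (\<Sum>i\<in>F. complex_of_real ((cmod (cinner (e i) v))\<^sup>2))"
    unfolding complex_norm_square by (subst cinner_commute[of v]) simp
  finally have "cinner v ?s = complex_of_real ?S"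
    by simp
  then have "?S \<le> norm v * norm ?s"
    using Cauchy_Schwarz_cinner[of v ?s] by (simp only: norm_of_real abs_of_nonneg sum_nonneg zero_le_power2)
  also have "norm ?s = sqrt ?S"
    using norm_sum_e[OF assms, of "\<lambda>i. cinner (e i) v"] by (metis norm_ge_zero real_sqrt_unique)
  finally have "sqrt ?S * sqrt ?S \<le> norm v * sqrt ?S"
    by (simp add: sum_nonneg)
  then have "sqrt ?S \<le> norm v"
    using mult_right_le_imp_le[of "sqrt ?S" "sqrt ?S" "norm v"] norm_ge_zero[of v]
    by argo
  then show ?thesis
    by (rule sqrt_le_D)
qed

lemma summable_cinner_sq: "summable (\<lambda>k. (cmod (cinner (e k) v))\<^sup>2)"
  by (rule summableI_nonneg_bounded[where x = "(norm v)\<^sup>2"]) (auto intro: Bessel)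

lemma summable_scaleC_e:
  assumes "summable (\<lambda>k. (cmod (c k))\<^sup>2)"
  shows "summable (\<lambda>k. c k *\<^sub>C e k)"
proof (subst summable_Cauchy, intro allI impI)
  fix \<epsilon> :: real assume "\<epsilon> > 0"
  then have "\<epsilon>\<^sup>2 > 0"
    by simp
  then obtain N where N: "\<And>m n. m \<ge> N \<Longrightarrow> norm (\<Sum>k=m..<n. (cmod (c k))\<^sup>2) < \<epsilon>\<^sup>2"
    using assms[unfolded summable_Cauchy, rule_format, of "\<epsilon>\<^sup>2"] by blast
  have "norm (\<Sum>k=m..<n. c k *\<^sub>C e k) < \<epsilon>" if "m \<ge> N" for m n
  proof -
    have "(norm (\<Sum>k=m..<n. c k *\<^sub>C e k))\<^sup>2 < \<epsilon>\<^sup>2"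
      using N[OF that, of n] by (subst norm_sum_e) (auto simp: sum_nonneg)
    then show ?thesis
      using \<open>\<epsilon> > 0\<close> by (auto intro: power2_less_imp_less[where y = \<epsilon>])
  qed
  then show "\<exists>N. \<forall>m\<ge>N. \<forall>n. norm (sum (\<lambda>k. c k *\<^sub>C e k) {m..<n}) < \<epsilon>"
    by (intro exI[of _ N]) simp
qed

lemma summable_diag_coeff:
  assumes "bounded (range d)"
  shows "summable (\<lambda>k. (cmod (complex_of_real (d k) * cinner (e k) v))\<^sup>2)"
proof -
  obtain C where C: "\<And>k. \<bar>d k\<bar> \<le> C"
    using assms by (auto simp: bounded_iff)
  show ?thesis
  proof (rule summable_comparison_test')
    show "summable (\<lambda>k. C\<^sup>2 * (cmod (cinner (e k) v))\<^sup>2)"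
      by (intro summable_mult summable_cinner_sq)
    show "norm ((cmod (complex_of_real (d k) * cinner (e k) v))\<^sup>2) \<le> C\<^sup>2 * (cmod (cinner (e k) v))\<^sup>2" for k
      using C[of k] by (auto simp: norm_mult power_mult_distrib intro!: mult_right_mono simp: abs_le_square_iff[symmetric])
  qed
qed

lemma diag_op_sums:
  assumes "bounded (range d)"
  shows "(\<lambda>k. (complex_of_real (d k) * cinner (e k) v) *\<^sub>C e k) sums diag_op e d v"
  unfolding diag_op_def
  by (rule summable_sums[OF summable_scaleC_e[OF summable_diag_coeff[OF assms]]])

lemma norm_diag_op_le:
  assumes "\<And>k. \<bar>d k\<bar> \<le> C"
  shows "norm (diag_op e d v) \<le> C * norm v"
proof -
  have d: "bounded (range d)"
    using assms by (auto simp: bounded_iff)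
  have C: "C \<ge> 0"
    using assms[of 0] by simp
  have "norm (\<Sum>k<N. (complex_of_real (d k) * cinner (e k) v) *\<^sub>C e k) \<le> C * norm v" for N
  proof -
    have "(norm (\<Sum>k<N. (complex_of_real (d k) * cinner (e k) v) *\<^sub>C e k))\<^sup>2
       = (\<Sum>k<N. (cmod (complex_of_real (d k) * cinner (e k) v))\<^sup>2)"
      by (rule norm_sum_e) simp
    also have "\<dots> \<le> (\<Sum>k<N. C\<^sup>2 * (cmod (cinner (e k) v))\<^sup>2)"
      using assms C
      by (intro sum_mono) (auto simp: norm_mult power_mult_distrib intro!: mult_right_mono simp: abs_le_square_iff[symmetric])
    also have "\<dots> \<le> C\<^sup>2 * (norm v)\<^sup>2"
      unfolding sum_distrib_left[symmetric] by (intro mult_left_mono Bessel) auto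
    finally show ?thesis
      using C by (auto intro: power2_le_imp_le[where y = "C * norm v"] simp: power_mult_distrib)
  qed
  then show ?thesis
    by (intro Lim_bounded[OF tendsto_norm[OF diag_op_sums[OF d, of v, unfolded sums_def]], of 0]) simp
qed

lemma diag_op_add_coeff:
  assumes "bounded (range d)" "bounded (range d')"
  shows "diag_op e (\<lambda>k. d k + d' k) v = diag_op e d v + diag_op e d' v"
proof -
  have "(\<lambda>k. (complex_of_real (d k) * cinner (e k) v) *\<^sub>C e k + (complex_of_real (d' k) * cinner (e k) v) *\<^sub>C e k)
     sums (diag_op e d v + diag_op e d' v)"
    by (intro sums_add diag_op_sums assms)
  then show ?thesis
    by (simp add: diag_op_def scaleC_add_left[symmetric] distrib_right sums_iff)
qed

lemma bounded_clinear_diag_op: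
  assumes "bounded (range d)"
  shows "bounded_clinear (diag_op e d)"
proof -
  obtain C where C: "\<And>k. \<bar>d k\<bar> \<le> C"
    using assms by (auto simp: bounded_iff)
  have add: "diag_op e d (u + v) = diag_op e d u + diag_op e d v" for u v
  proof -
    have "(\<lambda>k. (complex_of_real (d k) * cinner (e k) u) *\<^sub>C e k + (complex_of_real (d k) * cinner (e k) v) *\<^sub>C e k)
     sums (diag_op e d u + diag_op e d v)"
      by (intro sums_add diag_op_sums assms)
    then show ?thesis
      by (simp add: diag_op_def scaleC_add_left[symmetric] distrib_left[symmetric] sums_iff cinner_add_right)
  qed
  have scaleC: "diag_op e d (c *\<^sub>C v) = c *\<^sub>C diag_op e d v" for c v
  proof -
    have "(\<lambda>k. c *\<^sub>C ((complex_of_real (d k) * cinner (e k) v) *\<^sub>C e k)) sums (c *\<^sub>C diag_op e d v)"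
      by (intro bounded_linear.sums[OF bounded_linear_scaleC_right] diag_op_sums assms)
    then show ?thesis
      by (simp add: diag_op_def scaleC_scaleC sums_iff cinner_scaleC_right algebra_simps)
  qed
  have "bounded_linear (diag_op e d)"
    by (rule bounded_linear_intro[where K = C])
      (use norm_diag_op_le[OF C] in \<open>auto simp: add scaleC scaleR_scaleC mult.commute\<close>)
  with scaleC show ?thesis
    by (simp add: bounded_clinear_def)
qed

lemma cinner_e_diag_op:
  assumes "bounded (range d)"
  shows "cinner (e n) (diag_op e d v) = complex_of_real (d n) * cinner (e n) v"
proof -
  have "(\<lambda>k. cinner (e n) ((complex_of_real (d k) * cinner (e k) v) *\<^sub>C e k)) sums cinner (e n) (diag_op e d v)"
    by (intro bounded_linear.sums[OF bounded_linear_cinner_right] diag_op_sums assms)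
  moreover have "(\<lambda>k. cinner (e n) ((complex_of_real (d k) * cinner (e k) v) *\<^sub>C e k))
     = (\<lambda>k. if k = n then complex_of_real (d k) * cinner (e k) v else 0)"
    by (auto simp: cinner_scaleC_right cinner_e)
  ultimately show ?thesis
    using sums_unique2[OF _ sums_single[of n "\<lambda>k. complex_of_real (d k) * cinner (e k) v"]] by simp
qed

lemma diag_op_eigenvector:
  assumes "\<And>k. complex_of_real (d k) * cinner (e k) v = complex_of_real s * cinner (e k) v"
  shows "diag_op e d v = s *\<^sub>R v"
proof -
  have 1: "diag_op e (\<lambda>_. 1) = (\<lambda>v. v)"
  proof (rule bounded_clinear_eqI)
    show "diag_op e (\<lambda>_. 1) (e n) = e n" for n
    proof -
      have "(\<lambda>k. (cinner (e k) (e n)) *\<^sub>C e k) = (\<lambda>k. if k = n then e k else 0)"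
        by (auto simp: cinner_e)
      then show ?thesis
        using sums_single[of n e] by (simp add: diag_op_def sums_iff)
    qed
    show "bounded_clinear (diag_op e (\<lambda>_. 1))"
      by (rule bounded_clinear_diag_op) auto
  qed (auto simp: bounded_clinear_def bounded_linear_ident)
  have "(\<lambda>k. complex_of_real s *\<^sub>C (complex_of_real 1 * cinner (e k) v) *\<^sub>C e k) sums (complex_of_real s *\<^sub>C diag_op e (\<lambda>_. 1) v)"
    by (intro bounded_linear.sums[OF bounded_linear_scaleC_right] diag_op_sums) auto
  then show ?thesis
    unfolding diag_op_def[of e d] assms by (simp add: 1 scaleC_scaleC sums_iff scaleR_scaleC)
qed

lemma diag_op_e: "diag_op e d (e n) = d n *\<^sub>R e n"
  by (rule diag_op_eigenvector) (auto simp: cinner_e)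

lemma diag_op_diag_op:
  assumes "bounded (range d')"
  shows "diag_op e d (diag_op e d' v) = diag_op e (\<lambda>k. d k * d' k) v"
  unfolding diag_op_def[of e d] diag_op_def[of e "\<lambda>k. d k * d' k"]
  by (simp add: cinner_e_diag_op[OF assms] mult.assoc)

text \<open>
  An eigenvector of a diagonal operator for the eigenvalue \<open>s\<close> has nonzero coordinates only where the
  entry is \<open>s\<close>, so the operator with entries \<open>f (d k)\<close> multiplies it by \<open>f s\<close>. It is the only
  candidate, because the basis vectors themselves are eigenvectors.
\<close>
lemma fun_calc_diag_op:
  assumes "bounded (range d)" "bounded (range (\<lambda>k. f (d k)))"
  shows "fun_calc f (diag_op e d) = diag_op e (\<lambda>k. f (d k))"
  unfolding fun_calc_def
proof (rule the_equality)
  have "diag_op e (\<lambda>k. f (d k)) v = f s *\<^sub>R v" if "diag_op e d v = s *\<^sub>R v" for s v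
  proof (rule diag_op_eigenvector)
    fix k
    have "complex_of_real (d k) * cinner (e k) v = complex_of_real s * cinner (e k) v"
      using cinner_e_diag_op[OF assms(1), of k v]
      by (auto simp add: that cinner_scaleR_right scaleR_conv_of_real)
    then show "complex_of_real (f (d k)) * cinner (e k) v = complex_of_real (f s) * cinner (e k) v"
      by (cases "d k = s") auto
  qed
  then show "bounded_clinear (diag_op e (\<lambda>k. f (d k))) \<and>
      (\<forall>s v. diag_op e d v = s *\<^sub>R v \<longrightarrow> diag_op e (\<lambda>k. f (d k)) v = f s *\<^sub>R v)"
    using bounded_clinear_diag_op[OF assms(2)] by blast
next
  fix B assume "bounded_clinear B \<and> (\<forall>s v. diag_op e d v = s *\<^sub>R v \<longrightarrow> B v = f s *\<^sub>R v)"
  then show "B = diag_op e (\<lambda>k. f (d k))"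
    using bounded_clinear_diag_op[OF assms(2)] by (intro bounded_clinear_eqI) (auto simp: diag_op_e)
qed

lemma adj_diag_op:
  assumes "bounded (range d)"
  shows "adj (diag_op e d) = diag_op e d"
  unfolding adj_def
proof (rule the_equality)
  have *: "(\<lambda>k. complex_of_real (d k) * cinner (e k) v * cinner u (e k)) sums cinner u (diag_op e d v)" for u v
    using bounded_linear.sums[OF bounded_linear_cinner_right diag_op_sums[OF assms], of u v]
    by (simp add: cinner_scaleC_right)
  have "cinner u (diag_op e d v) = cinner (diag_op e d u) v" for u v
  proof -
    have "(\<lambda>k. cnj (complex_of_real (d k) * cinner (e k) u * cinner v (e k))) sums cnj (cinner v (diag_op e d u))"
      using * by (simp only: sums_cnj)
    moreover have "(\<lambda>k. cnj (complex_of_real (d k) * cinner (e k) u * cinner v (e k))) =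
        (\<lambda>k. complex_of_real (d k) * cinner (e k) v * cinner u (e k))"
      by (simp add: cinner_commute[symmetric] mult.commute mult.left_commute)
    ultimately show ?thesis
      using sums_unique2[OF *[of v u]] by (simp add: cinner_commute[of "diag_op e d u"])
  qed
  then show "\<forall>u v. cinner u (diag_op e d v) = cinner (diag_op e d u) v"
    by blast
  fix S assume "\<forall>u v. cinner u (diag_op e d v) = cinner (S u) v"
  with \<open>\<forall>u v. cinner u (diag_op e d v) = cinner (diag_op e d u) v\<close>
  show "S = diag_op e d"
    by (intro ext cinner_eqI) simp
qed

text \<open>
  The images of the unit ball under the truncations of a diagonal operator lie in such boxes.
\<close>
lemma compact_coordinate_box: "compact {\<Sum>k<N. c k *\<^sub>C e k | c. \<forall>k. cmod (c k) \<le> C}"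
proof (induction N)
  case 0
  then show ?case
    by (rule finite_imp_compact[OF finite_subset[of _ "{0}"]]) auto
next
  case (Suc N)
  have "compact ((\<lambda>c. c *\<^sub>C e N) ` cball 0 C)"
    by (intro compact_continuous_image linear_continuous_on bounded_linear_scaleC_left compact_cball)
  with Suc have "compact {x + y |x y. x \<in> {\<Sum>k<N. c k *\<^sub>C e k | c. \<forall>k. cmod (c k) \<le> C} \<and> y \<in> (\<lambda>c. c *\<^sub>C e N) ` cball 0 C}"
    by (rule compact_sums)
  also have "{x + y |x y. x \<in> {\<Sum>k<N. c k *\<^sub>C e k | c. \<forall>k. cmod (c k) \<le> C} \<and> y \<in> (\<lambda>c. c *\<^sub>C e N) ` cball 0 C}
     = {\<Sum>k<Suc N. c k *\<^sub>C e k | c. \<forall>k. cmod (c k) \<le> C}" (is "?L = ?R")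
  proof
    show "?L \<subseteq> ?R"
    proof clarsimp
      fix c :: "nat \<Rightarrow> complex" and b :: complex
      assume "\<forall>k. cmod (c k) \<le> C" "cmod b \<le> C"
      then show "\<exists>c'. (\<Sum>k<N. c k *\<^sub>C e k) + b *\<^sub>C e N = (\<Sum>k<N. c' k *\<^sub>C e k) + c' N *\<^sub>C e N \<and> (\<forall>k. cmod (c' k) \<le> C)"
        by (intro exI[of _ "c(N := b)"]) auto
    qed
    show "?R \<subseteq> ?L"
      by force
  qed
  finally show ?case .
qed

text \<open>
  The operator is a norm limit of its truncations to the first \<open>N\<close> entries. Hence the image of the unit
  ball lies within \<open>\<epsilon>/4\<close> of a compact box and is totally bounded.
\<close>
lemma compact_diag_op:
  assumes "d \<longlonglongrightarrow> 0"
  shows "compact_op (diag_op e d)"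
proof -
  have bd: "bounded (range d)"
    using assms by (simp add: convergent_imp_bounded)
  then obtain C where C: "\<And>k. \<bar>d k\<bar> \<le> C"
    by (auto simp: bounded_iff)
  let ?T = "diag_op e d ` cball 0 1"
  have "\<exists>k. finite k \<and> closure ?T \<subseteq> (\<Union>x\<in>k. ball x \<epsilon>)" if pos: "\<epsilon> > 0" for \<epsilon>
  proof -
    obtain N where N: "\<And>k. k \<ge> N \<Longrightarrow> \<bar>d k\<bar> < \<epsilon> / 4"
      using LIMSEQ_D[OF assms, of "\<epsilon> / 4"] pos by auto
    let ?box = "{\<Sum>k<N. c k *\<^sub>C e k | c. \<forall>k. cmod (c k) \<le> C}"
    obtain K where K: "finite K" "?box \<subseteq> (\<Union>x\<in>K. ball x (\<epsilon> / 4))"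
      using compact_coordinate_box[of N C, unfolded compact_eq_totally_bounded] pos
      by (elim conjE allE[of _ "\<epsilon> / 4"]) auto
    have "?T \<subseteq> (\<Union>x\<in>K. cball x (\<epsilon> / 2))"
    proof clarify
      fix v :: 'h assume v: "v \<in> cball 0 1"
      let ?s = "\<Sum>k<N. (complex_of_real (d k) * cinner (e k) v) *\<^sub>C e k"
      have "cmod (cinner (e k) v) \<le> 1" for k
      proof -
        have "norm (e k) = 1"
          using cinner_self[of "e k"] by (simp add: cinner_e)
            (metis norm_ge_zero of_real_1 of_real_eq_iff of_real_power power2_eq_1_iff neg_0_le_iff_le not_one_le_zero)
        then show ?thesis
          using Cauchy_Schwarz_cinner[of "e k" v] v by simp
      qed
      then have "cmod (complex_of_real (d k) * cinner (e k) v) \<le> C" for k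
        using mult_mono[OF C[of k], of "cmod (cinner (e k) v)" 1] C[of k] by (simp add: norm_mult)
      then have "?s \<in> ?box"
        by (intro CollectI exI[of _ "\<lambda>k. complex_of_real (d k) * cinner (e k) v"]) simp
      with K obtain x where x: "x \<in> K" "dist x ?s < \<epsilon> / 4"
        by (auto simp: subset_iff)
      define d0 where "d0 = (\<lambda>k. if k < N then d k else 0)"
      define d1 where "d1 = (\<lambda>k. if k < N then 0 else d k)"
      have bounds: "\<And>k. \<bar>d0 k\<bar> \<le> C" "\<And>k. \<bar>d1 k\<bar> \<le> C" "\<And>k. \<bar>d1 k\<bar> \<le> \<epsilon> / 4"
        using C N pos order_trans[OF abs_ge_zero C] by (auto simp: d0_def d1_def not_less less_imp_le)
      have "d = (\<lambda>k. d0 k + d1 k)"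
        by (auto simp: d0_def d1_def)
      moreover have "diag_op e (\<lambda>k. d0 k + d1 k) v = diag_op e d0 v + diag_op e d1 v"
        by (rule diag_op_add_coeff) (use bounds in \<open>auto simp: bounded_iff\<close>)
      moreover have "diag_op e d0 v = ?s"
        unfolding diag_op_def by (subst suminf_finite[of "{..<N}"]) (auto simp: d0_def)
      ultimately have "norm (diag_op e d v - ?s) = norm (diag_op e d1 v)"
        by simp
      also have "\<dots> \<le> \<epsilon> / 4 * norm v"
        by (intro norm_diag_op_le bounds)
      also have "\<dots> \<le> \<epsilon> / 4"
        using v pos by simp
      finally have "dist (diag_op e d v) ?s \<le> \<epsilon> / 4"
        by (simp add: dist_norm)
      with x have "dist x (diag_op e d v) \<le> \<epsilon> / 2"
        using dist_triangle2[of x "diag_op e d v" ?s] by simp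
      with x show "diag_op e d v \<in> (\<Union>x\<in>K. cball x (\<epsilon> / 2))"
        by auto
    qed
    then have "closure ?T \<subseteq> (\<Union>x\<in>K. cball x (\<epsilon> / 2))"
      by (rule closure_minimal) (use K in auto)
    also have "\<dots> \<subseteq> (\<Union>x\<in>K. ball x \<epsilon>)"
      using pos by (intro UN_mono) auto
    finally show ?thesis
      using K by blast
  qed
  moreover have "complete (closure ?T)"
    by (simp add: complete_eq_closed)
  ultimately have "compact (closure ?T)"
    unfolding compact_eq_totally_bounded by blast
  with bounded_clinear_diag_op[OF bd] show ?thesis
    by (simp add: compact_op_def)
qed

lemma Tr_diag_op: "Tr e (diag_op e d) = (\<Sum>n. ennreal (d n))"
  by (simp add: Tr_def diag_op_e cinner_scaleR_right cinner_e)

lemma powr_op_diag_op: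
  assumes "\<And>k. 0 \<le> d k" "bounded (range d)" "p \<ge> 0"
  shows "powr_op (diag_op e d) p = diag_op e (\<lambda>k. d k powr p)"
  unfolding powr_op_def
proof (rule fun_calc_diag_op[OF assms(2)])
  obtain C where "\<And>k. \<bar>d k\<bar> \<le> C"
    using assms(2) by (auto simp: bounded_iff)
  then have "d k \<le> C" for k
    by (metis abs_le_D1)
  then have "\<bar>d k powr p\<bar> \<le> C powr p" for k
    using assms(1,3) by (simp add: powr_mono2)
  then show "bounded (range (\<lambda>k. d k powr p))"
    by (auto simp: bounded_iff)
qed

lemma Tr_powr_op_diag_op:
  assumes "\<And>k. 0 \<le> d k" "bounded (range d)" "p \<ge> 0"
  shows "Tr e (powr_op (diag_op e d) p) = (\<Sum>k. ennreal (d k powr p))"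
  using assms by (simp add: powr_op_diag_op Tr_diag_op)

lemma abs_op_diag_op:
  assumes "bounded (range d)"
  shows "abs_op (diag_op e d) = diag_op e (\<lambda>k. \<bar>d k\<bar>)"
proof -
  obtain C where C: "\<And>k. \<bar>d k\<bar> \<le> C"
    using assms by (auto simp: bounded_iff)
  have "\<bar>d k * d k\<bar> \<le> C * C" for k
    using mult_mono[OF C C, of k k] C[of k] by (simp add: abs_mult)
  then have "bounded (range (\<lambda>k. d k * d k))"
    by (auto simp: bounded_iff)
  moreover have "adj (diag_op e d) \<circ> diag_op e d = diag_op e (\<lambda>k. d k * d k)"
    using assms by (auto simp: adj_diag_op diag_op_diag_op)
  moreover have "bounded (range (\<lambda>k. sqrt (d k * d k)))"
    using C by (auto simp: bounded_iff)
  ultimately show ?thesis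
    by (simp add: abs_op_def fun_calc_diag_op)
qed

lemma pos_part_diag_op:
  assumes "bounded (range d)"
  shows "pos_part (diag_op e d) = diag_op e (\<lambda>k. max (d k) 0)"
  unfolding pos_part_def
  by (intro fun_calc_diag_op bounded_range_if_abs_le[OF assms] assms) auto

lemma neg_part_diag_op:
  assumes "bounded (range d)"
  shows "neg_part (diag_op e d) = diag_op e (\<lambda>k. max (- d k) 0)"
  unfolding neg_part_def
  by (intro fun_calc_diag_op bounded_range_if_abs_le[OF assms] assms) auto

lemma Re_op_diag_op:
  assumes "bounded (range d)"
  shows "Re_op (diag_op e d) = diag_op e d"
  by (simp add: Re_op_def adj_diag_op[OF assms] scaleC_add_right scaleC_add_left[symmetric])

lemma Im_op_diag_op:
  assumes "bounded (range d)"
  shows "Im_op (diag_op e d) = diag_op e (\<lambda>_. 0)"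
  by (simp add: Im_op_def adj_diag_op[OF assms] diag_op_def[of e "\<lambda>_. 0"])

end

section \<open>Growth of the primitive and of the dyadic masses\<close>

text \<open>
  Squaring the argument of the primitive \<open>G\<close> doubles \<open>t\<close> in \<open>G(e\<^sup>t)\<close>; iterated, this controls the growth
  from \<open>t\<close> to all its dyadic multiples. In the application \<open>L\<close> is \<open>2\<^sup>\<alpha>\<close>.
\<close>
locale dyadic_density =
  fixes g :: "real \<Rightarrow> real" and L :: real
  assumes class_G: "g \<in> class_G"
    and primitive_square: "((\<lambda>t. primitive g (t powr 2) / primitive g t) \<longlongrightarrow> L) at_top"
begin

definition phi :: "real \<Rightarrow> real" where
  "phi t = primitive g (exp t)"

text \<open>
  The trace of the \<open>n\<close>-th dyadic block of the diagonal operator built from the constant sequence \<open>1\<close>.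
\<close>
definition mass :: "nat \<Rightarrow> real" where
  "mass n = 2 ^ n * g (2 ^ n)"

lemma g_pos: "t \<ge> 0 \<Longrightarrow> g t > 0"
  and g_antimono: "0 \<le> s \<Longrightarrow> s \<le> t \<Longrightarrow> g t \<le> g s"
  and g_tendsto_0: "(g \<longlongrightarrow> 0) at_top"
  and g_doubling: "((\<lambda>t. g (2 * t) / g t) \<longlongrightarrow> 1 / 2) at_top"
  using class_G by (auto simp: class_G_def monotone_on_def)

lemma mass_pos: "mass n > 0"
  by (simp add: mass_def g_pos)

lemma g_integrable: "0 \<le> a \<Longrightarrow> g integrable_on {a..b}"
proof -
  assume "0 \<le> a"
  then have "mono_on {a..b} (\<lambda>t. - g t)"
    by (auto simp: monotone_on_def intro: g_antimono)
  then show ?thesis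
    using integrable_on_mono_on integrable_neg_iff by blast
qed

lemma primitive_mono:
  assumes "0 \<le> s" "s \<le> t"
  shows "primitive g s \<le> primitive g t"
  unfolding primitive_def
  by (intro integral_subset_le g_integrable) (use assms g_pos in \<open>auto intro: less_imp_le\<close>)

lemma primitive_1_ge: "g 1 \<le> primitive g 1"
proof -
  have "integral {0..1} (\<lambda>_::real. g 1) \<le> integral {0..1} g"
    by (intro integral_le g_integrable) (auto intro: g_antimono)
  then show ?thesis
    by (simp add: primitive_def)
qed

lemma primitive_diff_ge:
  assumes "0 \<le> s" "s \<le> t"
  shows "(t - s) * g t \<le> primitive g t - primitive g s"
proof -
  have "integral {s..t} (\<lambda>_. g t) \<le> integral {s..t} g"
    using assms by (intro integral_le g_integrable) (auto intro: g_antimono)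
  moreover have "primitive g t = primitive g s + integral {s..t} g"
    using assms by (simp add: primitive_def Henstock_Kurzweil_Integration.integral_combine g_integrable)
  ultimately show ?thesis
    using assms by simp
qed

lemma phi_mono: "s \<le> t \<Longrightarrow> phi s \<le> phi t"
  by (simp add: phi_def primitive_mono)

lemma phi_pos:
  assumes "0 \<le> t"
  shows "phi t > 0"
proof -
  have "0 < primitive g 1"
    using primitive_1_ge g_pos[of 1] by simp
  also have "\<dots> \<le> phi t"
    using assms by (simp add: phi_def primitive_mono)
  finally show ?thesis .
qed

text \<open>
  As \<open>g\<close> decreases, \<open>mass (N+1)\<close> is at most twice the integral of \<open>g\<close> over \<open>[2\<^sup>N, 2^(N+1)]\<close>; the integrals
  telescope.
\<close>
lemma sum_mass_le_primitive: "(\<Sum>n\<le>N. mass n) \<le> 2 * primitive g (2 ^ N)"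
proof (induction N)
  case 0
  then show ?case
    using primitive_1_ge g_pos[of 1] by (simp add: mass_def)
next
  case (Suc N)
  have "mass (Suc N) = 2 * ((2 ^ Suc N - 2 ^ N) * g (2 ^ Suc N))"
    by (simp add: mass_def)
  also have "\<dots> \<le> 2 * (primitive g (2 ^ Suc N) - primitive g (2 ^ N))"
    by (intro mult_left_mono primitive_diff_ge) auto
  finally show ?case
    using Suc by simp
qed

lemma sum_mass_le_phi:
  assumes "finite A" "\<And>n. n \<in> A \<Longrightarrow> real n \<le> s" "0 \<le> s"
  shows "(\<Sum>n\<in>A. mass n) \<le> 2 * phi s"
proof -
  let ?N = "nat \<lfloor>s\<rfloor>"
  have "(\<Sum>n\<in>A. mass n) \<le> (\<Sum>n\<le>?N. mass n)"
    using assms by (intro sum_mono2) (auto simp: le_nat_floor intro: less_imp_le mass_pos)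
  also have "\<dots> \<le> 2 * primitive g (2 ^ ?N)"
    by (rule sum_mass_le_primitive)
  also have "primitive g (2 ^ ?N) \<le> phi s"
    unfolding phi_def
  proof (intro primitive_mono)
    have "(2::real) ^ ?N \<le> exp 1 ^ ?N"
      using exp_ge_add_one_self[of 1] by (intro power_mono) auto
    also have "\<dots> = exp (real ?N)"
      by (simp add: exp_of_nat_mult[symmetric])
    also have "\<dots> \<le> exp s"
      using assms by simp
    finally show "2 ^ ?N \<le> exp s" .
  qed simp
  finally show ?thesis
    by simp
qed

text \<open>
  In the variable \<open>ln t\<close>, squaring \<open>t\<close> is doubling.
\<close>
lemma phi_doubling: "\<exists>c t0. 1 \<le> c \<and> 0 < t0 \<and> (\<forall>t\<ge>t0. phi (2 * t) \<le> c * phi t)"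
proof -
  have "eventually (\<lambda>t. primitive g (t powr 2) / primitive g t < L + 1) at_top"
    using primitive_square by (rule order_tendstoD) simp
  then obtain s where s: "\<And>t. t \<ge> s \<Longrightarrow> primitive g (t powr 2) / primitive g t < L + 1"
    by (auto simp: eventually_at_top_linorder)
  have "phi (2 * t) \<le> max 1 (L + 1) * phi t" if "t \<ge> max 1 s" for t
  proof -
    have "s \<le> exp t"
      using that exp_ge_add_one_self[of t] by linarith
    moreover have "exp t powr 2 = exp (2 * t)"
      by (simp add: powr_def)
    ultimately have "phi (2 * t) / phi t < L + 1"
      using s[of "exp t"] by (simp add: phi_def)
    moreover have "phi t > 0"
      using that by (intro phi_pos) simp
    ultimately have "phi (2 * t) \<le> (L + 1) * phi t"
      by (simp add: divide_simps)
    also have "\<dots> \<le> max 1 (L + 1) * phi t"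
      using \<open>phi t > 0\<close> by (intro mult_right_mono) auto
    finally show ?thesis .
  qed
  then show ?thesis
    by (intro exI[of _ "max 1 (L + 1)"] exI[of _ "max 1 s"]) auto
qed

text \<open>
  A decreasing exponential lies below a combination of the step functions that are \<open>1\<close> up to
  \<open>2\<^sup>k t\<close>. On \<open>(2^(k-1) t, 2\<^sup>k t]\<close> the exponential is at most \<open>exp (- 2\<^sup>k / 8)\<close>, and the factor \<open>2\<close> serves to
  cover \<open>[0, t]\<close> with the same formula. Steps at these places suit the doubling estimate for
  \<^const>\<open>phi\<close>.
\<close>
lemma exp_le_dyadic_steps:
  fixes t :: real
  assumes "t > 0" "real n \<le> 2 ^ K * t"
  shows "exp (- real n / (4 * t)) \<le> (\<Sum>k\<le>K. if real n \<le> 2 ^ k * t then 2 * exp (- (2 ^ k) / 8) else 0)"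
    (is "_ \<le> (\<Sum>k\<le>K. ?w k)")
proof -
  define k where "k = (LEAST k. real n \<le> 2 ^ k * t)"
  have k: "real n \<le> 2 ^ k * t" "k \<le> K"
    unfolding k_def using assms by (auto intro: LeastI Least_le)
  have "exp (- real n / (4 * t)) \<le> 2 * exp (- (2 ^ k) / 8)"
  proof (cases k)
    case 0
    have "1 \<le> 2 * (1 + (- (1 / 8 :: real)))"
      by simp
    also have "\<dots> \<le> 2 * exp (- (1 / 8))"
      by (intro mult_left_mono exp_ge_add_one_self) simp
    finally have "1 \<le> 2 * exp (- (1 / 8 :: real))" .
    moreover have "exp (- real n / (4 * t)) \<le> 1"
      using assms by simp
    ultimately have "exp (- real n / (4 * t)) \<le> 2 * exp (- (1 / 8))"
      by (rule order_trans[rotated])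
    then show ?thesis
      using 0 by simp
  next
    case (Suc j)
    have "\<not> real n \<le> 2 ^ j * t"
      using not_less_Least[of j "\<lambda>k. real n \<le> 2 ^ k * t"] Suc by (simp add: k_def[symmetric])
    then have "2 ^ k / 8 \<le> real n / (4 * t)"
      using assms Suc by (simp add: field_simps)
    then have "exp (- real n / (4 * t)) \<le> exp (- (2 ^ k) / 8)"
      by simp
    also have "\<dots> \<le> 2 * exp (- (2 ^ k) / 8)"
      by simp
    finally show ?thesis .
  qed
  also have "\<dots> = ?w k"
    using k by simp
  also have "\<dots> \<le> (\<Sum>k\<le>K. ?w k)"
    using k by (intro member_le_sum) auto
  finally show ?thesis .
qed

lemma summable_power_exp:
  fixes c :: real
  assumes "c \<ge> 0"
  shows "summable (\<lambda>k. c ^ k * exp (- (2 ^ k) / 8))"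
proof -
  \<comment> \<open>this makes the ratio of consecutive terms, \<open>c exp (- 2\<^sup>k / 8) \<le> 8 c / 2\<^sup>k\<close>, at most \<open>1/2\<close>\<close>
  obtain N where N: "16 * c < 2 ^ N"
    using real_arch_pow[of 2 "16 * c"] by auto
  show ?thesis
  proof (rule summable_ratio_test[where c = "1/2" and N = N])
    fix k assume "k \<ge> N"
    have "16 * c \<le> 2 ^ k"
      using N power_increasing[OF \<open>k \<ge> N\<close>, of "2::real"] by linarith
    also have "\<dots> \<le> 8 * exp (2 ^ k / 8)"
      using exp_ge_add_one_self[of "2 ^ k / 8"] by linarith
    finally have "c * exp (- (2 ^ k / 8)) \<le> 1 / 2"
      by (simp add: exp_minus field_simps)
    then have "c * exp (- (2 ^ k / 8)) * (c ^ k * exp (- (2 ^ k) / 8)) \<le> 1 / 2 * (c ^ k * exp (- (2 ^ k) / 8))"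
      using assms by (intro mult_right_mono) auto
    moreover have "exp (- (2 ^ Suc k) / 8) = exp (- (2 ^ k / 8)) * exp (- (2 ^ k) / (8::real))"
      unfolding exp_add[symmetric] by (intro arg_cong[where f = exp]) simp
    ultimately show "norm (c ^ Suc k * exp (- (2 ^ Suc k) / 8)) \<le> 1 / 2 * norm (c ^ k * exp (- (2 ^ k) / 8))"
      using assms by (simp add: mult_ac)
  qed simp
qed

text \<open>
  Replacing the exponential by steps and exchanging the sums leaves the \<open>k\<close>-th weight times the mass
  up to \<open>2\<^sup>k t\<close>. That mass is at most \<open>2 phi (2\<^sup>k t) \<le> 2 c\<^sup>k phi t\<close>, and the weights decay faster than
  any geometric sequence.
\<close>
lemma sum_mass_exp_le_phi:
  "\<exists>C t0. 0 < C \<and> 0 < t0 \<and> (\<forall>t\<ge>t0. \<forall>M. (\<Sum>n<M. mass n * exp (- real n / (4 * t))) \<le> C * phi t)"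
proof -
  obtain c t0 where c: "1 \<le> c" "0 < t0" "\<And>t. t \<ge> t0 \<Longrightarrow> phi (2 * t) \<le> c * phi t"
    using phi_doubling by blast
  let ?w = "\<lambda>k::nat. 2 * exp (- (2 ^ k) / 8) :: real"
  define S where "S = (\<Sum>k. c ^ k * exp (- (2 ^ k) / 8))"
  have sm: "summable (\<lambda>k. c ^ k * exp (- (2 ^ k) / 8))"
    using c by (intro summable_power_exp) simp
  have "S > 0"
    unfolding S_def using c by (intro suminf_pos sm) auto
  have "(\<Sum>n<M. mass n * exp (- real n / (4 * t))) \<le> 4 * S * phi t" if t: "t \<ge> t0" for t M
  proof -
    have "t > 0" "phi t > 0"
      using t c by (auto intro: phi_pos)
    have iter: "phi (2 ^ k * t) \<le> c ^ k * phi t" for k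
    proof (induction k)
      case (Suc k)
      have "1 * t \<le> 2 ^ k * t"
        using \<open>t > 0\<close> by (intro mult_right_mono) auto
      then have "phi (2 * (2 ^ k * t)) \<le> c * phi (2 ^ k * t)"
        using t by (intro c) simp
      also have "\<dots> \<le> c * (c ^ k * phi t)"
        using Suc c by (intro mult_left_mono) auto
      finally show ?case
        by (simp add: mult_ac)
    qed simp
    obtain K where "real M / t < 2 ^ K"
      using real_arch_pow[of 2 "real M / t"] by auto
    then have K: "real M \<le> 2 ^ K * t"
      using \<open>t > 0\<close> by (simp add: field_simps)
    have "(\<Sum>n<M. mass n * exp (- real n / (4 * t)))
       \<le> (\<Sum>n<M. mass n * (\<Sum>k\<le>K. if real n \<le> 2 ^ k * t then ?w k else 0))"
      using K \<open>t > 0\<close>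
      by (intro sum_mono mult_left_mono exp_le_dyadic_steps) (auto intro: less_imp_le mass_pos)
    also have "\<dots> = (\<Sum>n<M. \<Sum>k\<le>K. if real n \<le> 2 ^ k * t then ?w k * mass n else 0)"
      unfolding sum_distrib_left by (intro sum.cong) auto
    also have "\<dots> = (\<Sum>k\<le>K. \<Sum>n<M. if real n \<le> 2 ^ k * t then ?w k * mass n else 0)"
      by (rule sum.swap)
    also have "\<dots> = (\<Sum>k\<le>K. ?w k * (\<Sum>n\<in>{n\<in>{..<M}. real n \<le> 2 ^ k * t}. mass n))"
      unfolding sum_distrib_left by (intro sum.cong refl sum.inter_filter[symmetric]) auto
    also have "\<dots> \<le> (\<Sum>k\<le>K. ?w k * (2 * phi (2 ^ k * t)))"
      using \<open>t > 0\<close> by (intro sum_mono mult_left_mono sum_mass_le_phi) auto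
    also have "\<dots> \<le> (\<Sum>k\<le>K. ?w k * (2 * (c ^ k * phi t)))"
      by (intro sum_mono mult_left_mono iter) auto
    also have "\<dots> = 4 * phi t * (\<Sum>k\<le>K. c ^ k * exp (- (2 ^ k) / 8))"
      unfolding sum_distrib_left by (intro sum.cong) auto
    also have "\<dots> \<le> 4 * phi t * S"
      unfolding S_def using \<open>phi t > 0\<close> c by (intro mult_left_mono sum_le_suminf sm) auto
    finally show ?thesis
      by (simp add: mult_ac)
  qed
  with \<open>S > 0\<close> c show ?thesis
    by (intro exI[of _ "4 * S"] exI[of _ t0]) auto
qed

text \<open>
  The increments of \<open>ln (mass n)\<close> tend to \<open>0\<close>.
\<close>
lemma ln_mass_sublinear:
  assumes "\<epsilon> > 0"
  shows "\<exists>K\<ge>0. \<forall>n. \<bar>ln (mass n)\<bar> \<le> \<epsilon> * real n + K"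
proof -
  have "filterlim (\<lambda>n. (2::real) ^ n) at_top sequentially"
    by (intro filterlim_at_infinity_imp_filterlim_at_top filterlim_realpow_sequentially_gt1) auto
  then have "(\<lambda>n. g (2 * 2 ^ n) / g (2 ^ n)) \<longlonglongrightarrow> 1 / 2"
    by (rule filterlim_compose[OF g_doubling])
  then have "(\<lambda>n. 2 * (g (2 * 2 ^ n) / g (2 ^ n))) \<longlonglongrightarrow> 2 * (1 / 2)"
    by (rule tendsto_mult_left)
  moreover have "(\<lambda>n. 2 * (g (2 * 2 ^ n) / g (2 ^ n))) = (\<lambda>n. mass (Suc n) / mass n)"
    by (auto simp: mass_def)
  ultimately have "(\<lambda>n. mass (Suc n) / mass n) \<longlonglongrightarrow> 1"
    by simp
  then have "(\<lambda>n. ln (mass (Suc n) / mass n)) \<longlonglongrightarrow> ln 1"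
    by (rule tendsto_ln) simp
  then have "(\<lambda>n. ln (mass (Suc n) / mass n)) \<longlonglongrightarrow> 0"
    by simp
  from LIMSEQ_D[OF this assms]
  obtain N where N: "\<And>n. n \<ge> N \<Longrightarrow> \<bar>ln (mass (Suc n) / mass n)\<bar> < \<epsilon>"
    by auto
  have step: "\<bar>ln (mass (Suc n))\<bar> \<le> \<bar>ln (mass n)\<bar> + \<epsilon>" if "n \<ge> N" for n
    using N[OF that] mass_pos[of n] mass_pos[of "Suc n"] by (simp add: ln_div)
  have far: "\<bar>ln (mass (N + m))\<bar> \<le> \<bar>ln (mass N)\<bar> + \<epsilon> * real m" for m
  proof (induction m)
    case (Suc m)
    then show ?case
      using step[of "N + m"] by (simp add: algebra_simps)
  qed simp
  define K where "K = (\<Sum>n\<le>N. \<bar>ln (mass n)\<bar>)"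
  have near: "\<bar>ln (mass n)\<bar> \<le> K" if "n \<le> N" for n
    unfolding K_def using that by (intro member_le_sum) auto
  have "\<bar>ln (mass n)\<bar> \<le> \<epsilon> * real n + K" for n
  proof (cases "n \<le> N")
    case True
    then show ?thesis
      using near[of n] mult_nonneg_nonneg[of \<epsilon> "real n"] assms by linarith
  next
    case False
    then have "\<bar>ln (mass n)\<bar> \<le> \<bar>ln (mass N)\<bar> + \<epsilon> * real (n - N)"
      using far[of "n - N"] by simp
    also have "\<dots> \<le> K + \<epsilon> * real n"
      using assms by (intro add_mono near mult_left_mono) auto
    finally show ?thesis
      by simp
  qed
  moreover have "K \<ge> 0"
    by (simp add: K_def sum_nonneg)
  ultimately show ?thesis
    by blast
qed

end

section \<open>Comparison of a single term of the trace with the Dirichlet series\<close>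

lemma abs_exp_minus_one_le: "\<bar>exp x - 1\<bar> \<le> \<bar>x\<bar> * exp \<bar>x :: real\<bar>"
proof (cases "x \<ge> 0")
  case True
  have "1 - x \<le> exp (- x)"
    using exp_ge_add_one_self[of "- x"] by simp
  then have "(1 - x) * exp x \<le> exp (- x) * exp x"
    by (intro mult_right_mono) auto
  then show ?thesis
    using True by (simp add: exp_minus algebra_simps)
next
  case False
  then have "exp x \<le> 1"
    by simp
  then have "\<bar>exp x - 1\<bar> \<le> \<bar>x\<bar> * 1"
    using exp_ge_add_one_self[of x] False by linarith
  also have "\<dots> \<le> \<bar>x\<bar> * exp \<bar>x\<bar>"
    by (intro mult_left_mono) auto
  finally show ?thesis .
qed

text \<open>
  Write the difference as \<open>y (exp (ln y / t) - 1)\<close>. Below \<open>1\<close> the singularity of the logarithm is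
  cancelled by the factor \<open>y\<close>, because \<open>y |ln y| \<le> 1\<close>; above \<open>1\<close> all the factors are bounded by \<open>C\<close>.
\<close>
lemma abs_powr_minus_self_le:
  fixes y C t :: real
  assumes "0 \<le> y" "y \<le> C" "1 \<le> C" "1 \<le> t"
  shows "\<bar>y powr (1 + 1 / t) - y\<bar> \<le> C ^ 3 / t"
proof (cases "y = 0")
  case False
  then have y: "y > 0"
    using assms by simp
  have eq: "y powr (1 + 1 / t) - y = y * (exp (ln y / t) - 1)"
    using y by (simp add: powr_add powr_def[of y "1 / t"] algebra_simps)
  show ?thesis
  proof (cases "y \<le> 1")
    case True
    have "\<bar>y * (exp (ln y / t) - 1)\<bar> \<le> y * (- (ln y / t))"
    proof -
      have "exp (ln y / t) \<le> 1"
        using True y assms by (simp add: divide_le_0_iff)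
      then have "\<bar>exp (ln y / t) - 1\<bar> \<le> - (ln y / t)"
        using exp_ge_add_one_self[of "ln y / t"] by linarith
      then show ?thesis
        unfolding abs_mult using y by (intro mult_mono) auto
    qed
    also have "\<dots> \<le> 1 / t"
    proof -
      have "- ln y \<le> 1 / y - 1"
        using ln_le_minus_one[of "1 / y"] y by (simp add: ln_div)
      then have "y * (- ln y) \<le> y * (1 / y)"
        using y by (intro mult_left_mono) auto
      then show ?thesis
        using y assms by (simp add: field_simps)
    qed
    also have "\<dots> \<le> C ^ 3 / t"
      using assms by (intro divide_right_mono one_le_power) auto
    finally show ?thesis
      unfolding eq .
  next
    case False
    have ln: "0 \<le> ln y" "ln y \<le> C"
      using False y assms ln_le_minus_one[of y] by auto
    have "exp (ln y / t) \<le> exp (ln y)"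
      using ln assms by (simp add: divide_le_eq mult_left_le_one_le mult_le_cancel_left1)
    then have e: "exp (ln y / t) \<le> C"
      using y assms by simp
    have "\<bar>y * (exp (ln y / t) - 1)\<bar> \<le> y * (ln y / t * exp (ln y / t))"
      using abs_exp_minus_one_le[of "ln y / t"] y ln assms
      unfolding abs_mult by (intro mult_mono) auto
    also have "\<dots> \<le> C * (C / t * C)"
      using ln e y assms by (intro mult_mono divide_right_mono) auto
    also have "\<dots> = C ^ 3 / t"
      by (simp add: power3_eq_cube)
    finally show ?thesis
      unfolding eq .
  qed
qed (use assms in auto)

text \<open>
  Since \<open>2/3 - 1/4 = 1/4 + 1/6\<close> and \<open>ln 2 \<ge> 2/3\<close>, the decay of \<open>2^(-u)\<close> pays for the growth \<open>e^(\<epsilon>u)\<close>, leaves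
  \<open>e^(-u/4)\<close>, and has \<open>e^(-u/6)\<close> to spare for a factor \<open>u\<close>.
\<close>
lemma two_powr_times_exp_le:
  fixes u \<epsilon> :: real
  assumes "0 \<le> u" "\<epsilon> \<le> 1 / 4"
  shows "2 powr (- u) * exp (\<epsilon> * u) \<le> exp (- u / 4)"
    and "u * (2 powr (- u) * exp (\<epsilon> * u)) \<le> 6 * exp (- u / 4)"
proof -
  have "2 powr (- u) * exp (\<epsilon> * u) = exp (- u * ln 2 + \<epsilon> * u)"
    unfolding exp_add by (simp add: powr_def)
  also have "\<dots> \<le> exp (- u * (2 / 3) + 1 / 4 * u)"
    using assms ln2_ge_two_thirds unfolding exp_le_cancel_iff
    by (intro add_mono mult_right_mono mult_left_mono_neg) auto
  also have "\<dots> = exp (- u / 6) * exp (- u / 4)"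
    unfolding exp_add[symmetric] by (intro arg_cong[where f = exp]) (simp add: field_simps)
  finally have *: "2 powr (- u) * exp (\<epsilon> * u) \<le> exp (- u / 6) * exp (- u / 4)" .
  also have "\<dots> \<le> 1 * exp (- u / 4)"
    using assms by (intro mult_right_mono) auto
  finally show "2 powr (- u) * exp (\<epsilon> * u) \<le> exp (- u / 4)"
    by simp
  have "u * (2 powr (- u) * exp (\<epsilon> * u)) \<le> (u * exp (- u / 6)) * exp (- u / 4)"
    using mult_left_mono[OF * assms(1)] by (simp add: mult_ac)
  also have "u * exp (- u / 6) \<le> 6"
  proof -
    have "u \<le> 6 * exp (u / 6)"
      using exp_ge_add_one_self[of "u / 6"] by linarith
    then show ?thesis
      by (simp add: exp_minus field_simps)
  qed
  finally show "u * (2 powr (- u) * exp (\<epsilon> * u)) \<le> 6 * exp (- u / 4)"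
    by simp
qed

context dyadic_density
begin

text \<open>
  With \<open>u = n / t\<close> and \<open>l = ln (mass n)\<close> the two terms are \<open>mass n * 2 powr (- u)\<close> times \<open>y powr (1 + 1 / t) *
  exp (l / t)\<close> and times \<open>y\<close>. By the sublinear bound \<open>|l| / t \<le> \<epsilon> u + K / t\<close>, so the difference of the
  last factors is of order \<open>1 / t + \<epsilon> u\<close> times \<open>exp (\<epsilon> u)\<close>, uniformly in \<open>n\<close> and in \<open>y \<le> C\<close>.
\<close>
lemma trace_term_approx:
  assumes "1 \<le> C" "0 < \<eta>"
  shows "eventually (\<lambda>t. \<forall>n y. 0 \<le> y \<longrightarrow> y \<le> C \<longrightarrow>
    \<bar>2 ^ n * (y * g (2 ^ n)) powr (1 + 1 / t) - y * 2 powr (- real n / t) * 2 ^ n * g (2 ^ n)\<bar>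
      \<le> \<eta> * (mass n * exp (- real n / (4 * t)))) at_top"
proof -
  \<comment> \<open>the bound below collects \<open>18 C \<epsilon>\<close> from the factor \<open>\<epsilon> u\<close>; half of \<open>\<eta>\<close> is reserved for it\<close>
  define \<epsilon> where "\<epsilon> = min (1 / 4) (\<eta> / (36 * C))"
  have \<epsilon>: "0 < \<epsilon>" "\<epsilon> \<le> 1 / 4" "18 * C * \<epsilon> \<le> \<eta> / 2"
  proof -
    show "18 * C * \<epsilon> \<le> \<eta> / 2"
      using mult_left_mono[of \<epsilon> "\<eta> / (36 * C)" "18 * C"] assms by (simp add: \<epsilon>_def)
  qed (use assms in \<open>auto simp: \<epsilon>_def\<close>)
  obtain K where K: "K \<ge> 0" "\<And>n. \<bar>ln (mass n)\<bar> \<le> \<epsilon> * real n + K"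
    using ln_mass_sublinear[OF \<epsilon>(1)] by blast
  \<comment> \<open>from here on \<open>exp (K / t) \<le> 3\<close>, and the part of order \<open>1 / t\<close> is at most the other half of \<open>\<eta>\<close>\<close>
  define T where "T = max (max 1 K) (6 * (C ^ 3 + C * K) / \<eta>)"
  have "\<bar>2 ^ n * (y * g (2 ^ n)) powr (1 + 1 / t) - y * 2 powr (- real n / t) * 2 ^ n * g (2 ^ n)\<bar>
      \<le> \<eta> * (mass n * exp (- real n / (4 * t)))"
    if t: "t \<ge> T" and y: "0 \<le> y" "y \<le> C" for t y n
  proof -
    have t1: "t \<ge> 1" "K \<le> t" and t_large: "6 * (C ^ 3 + C * K) \<le> \<eta> * t"
      using t assms by (auto simp: T_def field_simps)
    define u where "u = real n / t"
    define l where "l = ln (mass n)"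
    define b where "b = \<epsilon> * u + K / t"
    have u: "u \<ge> 0"
      using t1 by (simp add: u_def)
    have l: "\<bar>l / t\<bar> \<le> b"
    proof -
      have "\<bar>l\<bar> / t \<le> (\<epsilon> * real n + K) / t"
        using K(2)[of n] t1 unfolding l_def by (intro divide_right_mono) auto
      then show ?thesis
        using t1 by (simp add: b_def u_def add_divide_distrib)
    qed
    have "b \<ge> 0"
      using l by linarith
    have e_b: "exp b \<le> 3 * exp (\<epsilon> * u)"
    proof -
      have "exp (K / t) \<le> exp 1"
        using t1 K by simp
      also have "\<dots> \<le> (3::real)"
        by (rule exp_le)
      finally have "exp (\<epsilon> * u) * exp (K / t) \<le> exp (\<epsilon> * u) * 3"
        by (intro mult_left_mono) auto
      then show ?thesis
        unfolding b_def exp_add by (simp add: mult.commute)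
    qed
    have e1: "exp (l / t) \<le> exp b"
      using order_trans[OF abs_ge_self l] by simp
    have e2: "\<bar>exp (l / t) - 1\<bar> \<le> b * exp b"
    proof -
      have "\<bar>exp (l / t) - 1\<bar> \<le> \<bar>l / t\<bar> * exp \<bar>l / t\<bar>"
        by (rule abs_exp_minus_one_le)
      also have "\<dots> \<le> b * exp b"
        using l \<open>b \<ge> 0\<close> by (intro mult_mono) auto
      finally show ?thesis .
    qed
    have g_eq: "g (2 ^ n) = mass n / 2 ^ n"
      by (simp add: mass_def)
    have "2 ^ n * g (2 ^ n) powr (1 + 1 / t) = mass n * (2 powr (- u) * exp (l / t))"
    proof -
      have "ln (g (2 ^ n)) = l - real n * ln 2"
        using mass_pos[of n] by (simp add: g_eq l_def ln_div ln_realpow)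
      moreover have "2 ^ n * g (2 ^ n) powr (1 + 1 / t) = mass n * exp (ln (g (2 ^ n)) / t)"
        using g_pos[of "2 ^ n"] by (simp add: powr_add powr_def[of _ "1 / t"] mass_def)
      moreover have "2 powr (- u) = exp (- (real n * ln 2) / t)"
        by (simp add: powr_def u_def)
      ultimately show ?thesis
        by (simp add: exp_add[symmetric] diff_divide_distrib)
    qed
    then have "2 ^ n * (y * g (2 ^ n)) powr (1 + 1 / t) = y powr (1 + 1 / t) * (mass n * (2 powr (- u) * exp (l / t)))"
      using y g_pos[of "2 ^ n"] by (simp add: powr_mult mult_ac)
    moreover have "y * 2 powr (- real n / t) * 2 ^ n * g (2 ^ n) = y * (mass n * 2 powr (- u))"
      by (simp add: u_def mass_def)
    ultimately have "\<bar>2 ^ n * (y * g (2 ^ n)) powr (1 + 1 / t) - y * 2 powr (- real n / t) * 2 ^ n * g (2 ^ n)\<bar>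
      = \<bar>mass n * 2 powr (- u) * (y powr (1 + 1 / t) * exp (l / t) - y)\<bar>"
      by (simp only: right_diff_distrib mult_ac)
    also have "\<dots> = mass n * 2 powr (- u) * \<bar>y powr (1 + 1 / t) * exp (l / t) - y\<bar>"
      using mass_pos[of n] by (simp add: abs_mult)
    also have "\<dots> \<le> mass n * 2 powr (- u) * (3 * exp (\<epsilon> * u) * (C ^ 3 / t + C * b))"
    proof -
      have "\<bar>y powr (1 + 1 / t) * exp (l / t) - y\<bar>
         = \<bar>(y powr (1 + 1 / t) - y) * exp (l / t) + y * (exp (l / t) - 1)\<bar>"
        by (simp add: algebra_simps)
      also have "\<dots> \<le> \<bar>y powr (1 + 1 / t) - y\<bar> * exp (l / t) + y * \<bar>exp (l / t) - 1\<bar>"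
        using y by (intro order_trans[OF abs_triangle_ineq]) (simp add: abs_mult)
      also have "\<dots> \<le> C ^ 3 / t * exp b + C * (b * exp b)"
        using y e1 e2 assms t1 by (intro add_mono mult_mono abs_powr_minus_self_le) auto
      also have "\<dots> = exp b * (C ^ 3 / t + C * b)"
        by (simp add: algebra_simps)
      also have "\<dots> \<le> 3 * exp (\<epsilon> * u) * (C ^ 3 / t + C * b)"
        using e_b assms t1 \<open>b \<ge> 0\<close> by (intro mult_right_mono) auto
      finally show ?thesis
        using mass_pos[of n] by (intro mult_left_mono) auto
    qed
    also have "\<dots> = mass n * (3 * ((C ^ 3 + C * K) / t) * (2 powr (- u) * exp (\<epsilon> * u))
        + 3 * C * \<epsilon> * (u * (2 powr (- u) * exp (\<epsilon> * u))))"
      by (simp add: b_def algebra_simps add_divide_distrib)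
    also have "\<dots> \<le> mass n * (3 * ((C ^ 3 + C * K) / t) * exp (- u / 4) + 3 * C * \<epsilon> * (6 * exp (- u / 4)))"
      using two_powr_times_exp_le[OF u \<epsilon>(2)] mass_pos[of n] K assms t1 \<epsilon>
      by (intro mult_left_mono add_mono) auto
    also have "\<dots> = (3 * ((C ^ 3 + C * K) / t) + 18 * C * \<epsilon>) * (mass n * exp (- u / 4))"
      by (simp add: algebra_simps)
    also have "\<dots> \<le> \<eta> * (mass n * exp (- u / 4))"
    proof -
      have "3 * ((C ^ 3 + C * K) / t) \<le> \<eta> / 2"
        using t_large t1 by (simp add: field_simps)
      then have "3 * ((C ^ 3 + C * K) / t) + 18 * C * \<epsilon> \<le> \<eta>"
        using \<epsilon>(3) by linarith
      then show ?thesis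
        using mass_pos[of n] by (intro mult_right_mono) auto
    qed
    finally show ?thesis
      by (simp add: u_def mult.commute)
  qed
  then show ?thesis
    unfolding eventually_at_top_linorder by blast
qed

end

section \<open>Sums over the dyadic blocks\<close>

lemma dyadic_level_eqI:
  assumes "2 ^ n \<le> k + 1" "k + 1 < 2 ^ (n + 1)"
  shows "dyadic_level k = n"
proof -
  have "\<lfloor>log (real 2) (real (k + 1))\<rfloor> = int n"
    using assms by (intro floor_log_nat_eq_if) auto
  then show ?thesis
    by (simp add: dyadic_level_def)
qed

lemma dyadic_level_ge:
  assumes "2 ^ n \<le> k + 1"
  shows "n \<le> dyadic_level k"
proof -
  have "real n = log 2 (2 ^ n)"
    by simp
  also have "\<dots> \<le> log 2 (real (k + 1))"
    using assms by (intro log_mono) (auto simp flip: of_nat_power of_nat_Suc simp: of_nat_le_iff[symmetric])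
  finally show ?thesis
    by (simp add: dyadic_level_def le_nat_floor)
qed

lemma filterlim_dyadic_level: "filterlim dyadic_level at_top at_top"
  unfolding filterlim_at_top
proof
  fix n
  show "eventually (\<lambda>k. n \<le> dyadic_level k) at_top"
    using eventually_ge_at_top[of "2 ^ n"] by eventually_elim (auto intro: dyadic_level_ge)
qed

lemma sum_dyadic_level:
  fixes f :: "nat \<Rightarrow> ennreal"
  shows "(\<Sum>k<2 ^ N - 1. f (dyadic_level k)) = (\<Sum>n<N. 2 ^ n * f n)"
proof (induction N)
  case (Suc N)
  have split: "{..<2 ^ Suc N - 1} = {..<2 ^ N - 1} \<union> {2 ^ N - 1..<2 ^ Suc N - (1::nat)}"
    by auto
  have "(\<Sum>k<2 ^ Suc N - 1. f (dyadic_level k))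
    = (\<Sum>k<2 ^ N - 1. f (dyadic_level k)) + (\<Sum>k\<in>{2 ^ N - 1..<2 ^ Suc N - 1}. f (dyadic_level k))"
    unfolding split by (rule sum.union_disjoint) auto
  also have "(\<Sum>k\<in>{2 ^ N - 1..<2 ^ Suc N - 1}. f (dyadic_level k)) = (\<Sum>k\<in>{2 ^ N - 1..<2 ^ Suc N - (1::nat)}. f N)"
    by (intro sum.cong refl arg_cong[where f = f] dyadic_level_eqI) auto
  also have "\<dots> = 2 ^ N * f N"
    by (simp add: mult_2)
  finally show ?case
    using Suc by simp
qed simp

lemma suminf_dyadic_level:
  fixes f :: "nat \<Rightarrow> ennreal"
  shows "(\<Sum>k. f (dyadic_level k)) = (\<Sum>n. 2 ^ n * f n)"
proof (rule LIMSEQ_unique)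
  have "(\<lambda>M. \<Sum>k<M. f (dyadic_level k)) \<longlonglongrightarrow> (\<Sum>k. f (dyadic_level k))"
    by (rule summable_LIMSEQ) simp
  moreover have "strict_mono (\<lambda>N. 2 ^ N - (1::nat))"
    by (intro strict_monoI_Suc) (simp add: diff_less_mono)
  ultimately show "(\<lambda>N. \<Sum>n<N. 2 ^ n * f n) \<longlonglongrightarrow> (\<Sum>k. f (dyadic_level k))"
    unfolding sum_dyadic_level[symmetric] by (rule LIMSEQ_subseq_LIMSEQ[unfolded comp_def])
  show "(\<lambda>N. \<Sum>n<N. 2 ^ n * f n) \<longlonglongrightarrow> (\<Sum>n. 2 ^ n * f n)"
    by (rule summable_LIMSEQ) simp
qed

section \<open>Extended limits\<close>

text \<open>
  These are the functions to which \<^const>\<open>EL_apply\<close> is meant to be applied.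
\<close>
definition eventually_Linf :: "(real \<Rightarrow> real) \<Rightarrow> bool" where
  "eventually_Linf f \<longleftrightarrow>
     (\<exists>t0>0. f \<in> borel_measurable (lebesgue_on {t0<..}) \<and> bounded (f ` {t0<..}))"

lemma eventually_LinfI:
  assumes "f \<in> borel_measurable borel" "eventually (\<lambda>t. \<bar>f t\<bar> \<le> C) at_top"
  shows "eventually_Linf f"
proof -
  obtain t0 where t0: "\<And>t. t \<ge> t0 \<Longrightarrow> \<bar>f t\<bar> \<le> C"
    using assms(2) by (auto simp: eventually_at_top_linorder)
  have "f \<in> borel_measurable (lebesgue_on {max t0 1<..})"
    using assms(1) by (intro measurable_restrict_space1 measurable_completion) simp
  moreover have "bounded (f ` {max t0 1<..})"
    using t0 by (auto simp: bounded_iff intro!: exI[of _ C])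
  ultimately show ?thesis
    unfolding eventually_Linf_def by (intro exI[of _ "max t0 1"]) auto
qed

lemma eventually_Linf_cong:
  assumes "eventually_Linf f" "\<And>t. t > 0 \<Longrightarrow> f t = f' t"
  shows "eventually_Linf f'"
proof -
  obtain t0 where t0: "t0 > 0" "f \<in> borel_measurable (lebesgue_on {t0<..})" "bounded (f ` {t0<..})"
    using assms(1) by (auto simp: eventually_Linf_def)
  have "f' ` {t0<..} = f ` {t0<..}"
    using assms(2) t0(1) by (intro image_cong) auto
  moreover have "f' \<in> borel_measurable (lebesgue_on {t0<..})"
    using t0 assms(2) by (subst measurable_lebesgue_cong[of _ f' f]) auto
  ultimately show ?thesis
    using t0 by (auto simp: eventually_Linf_def)
qed

lemma cut_off_Linf:
  assumes "0 < t0" "f \<in> borel_measurable (lebesgue_on {t0<..})" "bounded (f ` {t0<..})"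
  shows "(\<lambda>t. f t * indicator {t0<..} t) \<in> Linf"
proof -
  obtain C where C: "\<And>t. t > t0 \<Longrightarrow> \<bar>f t\<bar> \<le> C"
    using assms(3) by (auto simp: bounded_iff)
  have "(\<lambda>t. if t \<in> {t0<..} then f t else 0) \<in> borel_measurable lebesgue"
    using assms(2) by (subst borel_measurable_if) auto
  moreover have "(\<lambda>t. if t \<in> {t0<..} then f t else 0) = (\<lambda>t. f t * indicator {t0<..} t)"
    by (auto simp: indicator_def)
  ultimately have "(\<lambda>t. f t * indicator {t0<..} t) \<in> borel_measurable (lebesgue_on {0<..})"
    by (simp add: measurable_restrict_space1)
  moreover have "AE t in lebesgue_on {0<..}. \<bar>f t * indicator {t0<..} t\<bar> \<le> max C 0"
    using C by (intro AE_I2) (auto simp: indicator_def le_max_iff_disj)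
  ultimately show ?thesis
    by (auto simp: Linf_def)
qed

lemma
  assumes "f \<in> Linf" "f' \<in> Linf"
  shows Linf_diff: "(\<lambda>t. f t - f' t) \<in> Linf" and Linf_uminus: "(\<lambda>t. - f t) \<in> Linf"
proof -
  obtain C C' where "AE t in lebesgue_on {0<..}. \<bar>f t\<bar> \<le> C" "AE t in lebesgue_on {0<..}. \<bar>f' t\<bar> \<le> C'"
    using assms by (auto simp: Linf_def)
  then have "AE t in lebesgue_on {0<..}. \<bar>f t - f' t\<bar> \<le> C + C'"
    by eventually_elim auto
  then show "(\<lambda>t. f t - f' t) \<in> Linf"
    using assms unfolding Linf_def by auto
  show "(\<lambda>t. - f t) \<in> Linf"
    using assms unfolding Linf_def by auto
qed

lemma has_ess_limI:
  assumes "(f \<longlongrightarrow> c) at_top"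
  shows "has_ess_lim f c"
  unfolding has_ess_lim_def
proof (intro allI impI)
  fix \<epsilon> :: real assume "\<epsilon> > 0"
  then obtain t0 where "\<And>t. t \<ge> t0 \<Longrightarrow> \<bar>f t - c\<bar> < \<epsilon>"
    using tendstoD[OF assms] by (auto simp: eventually_at_top_linorder dist_real_def)
  then show "\<exists>t0. AE t in lebesgue_on {0<..}. t > t0 \<longrightarrow> \<bar>f t - c\<bar> < \<epsilon>"
    by (intro exI[of _ t0] AE_I2) auto
qed

lemma EL_diff:
  assumes "\<gamma> \<in> EL" "f \<in> Linf" "f' \<in> Linf"
  shows "\<gamma> (\<lambda>t. f t - f' t) = \<gamma> f - \<gamma> f'"
proof -
  have neg: "\<gamma> (\<lambda>t. - f' t) = - \<gamma> f'"
  proof -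
    have "\<forall>a. \<forall>f\<in>Linf. \<gamma> (\<lambda>t. a * f t) = a * \<gamma> f"
      using assms(1) unfolding EL_def mem_Collect_eq by (elim conjE)
    from this[rule_format, of f' "-1"] show ?thesis
      using assms by simp
  qed
  have "\<forall>f\<in>Linf. \<forall>h\<in>Linf. \<gamma> (\<lambda>t. f t + h t) = \<gamma> f + \<gamma> h"
    using assms(1) unfolding EL_def mem_Collect_eq by (elim conjE)
  from this[rule_format, of f "\<lambda>t. - f' t"] show ?thesis
    using assms neg by (simp add: Linf_uminus)
qed

text \<open>
  The cut-off points chosen by \<^const>\<open>EL_apply\<close> for the three functions need not agree, but past all
  of them the cut-off functions satisfy the hypothesis, and an extended limit only sees the behaviour
  at infinity.
\<close>
lemma EL_apply_diff_eqI:
  assumes \<gamma>: "\<gamma> \<in> EL"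
    and Linf: "eventually_Linf f1" "eventually_Linf f2" "eventually_Linf f3"
    and lim: "((\<lambda>t. f1 t - f2 t - f3 t) \<longlongrightarrow> 0) at_top"
  shows "EL_apply \<gamma> f1 - EL_apply \<gamma> f2 = EL_apply \<gamma> f3"
proof -
  have *: "\<exists>t0>0. EL_apply \<gamma> f = \<gamma> (\<lambda>t. f t * indicator {t0<..} t) \<and> (\<lambda>t. f t * indicator {t0<..} t) \<in> Linf"
    if "eventually_Linf f" for f
  proof -
    define t0 where "t0 = (SOME t0. t0 > 0 \<and> f \<in> borel_measurable (lebesgue_on {t0<..}) \<and> bounded (f ` {t0<..}))"
    from that have "t0 > 0 \<and> f \<in> borel_measurable (lebesgue_on {t0<..}) \<and> bounded (f ` {t0<..})"
      unfolding eventually_Linf_def t0_def by (rule someI_ex)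
    then show ?thesis
      unfolding EL_apply_def t0_def[symmetric] Let_def
      by (intro exI[of _ t0]) (auto intro: cut_off_Linf)
  qed
  obtain t1 t2 t3
    where 1: "EL_apply \<gamma> f1 = \<gamma> (\<lambda>t. f1 t * indicator {t1<..} t)" "(\<lambda>t. f1 t * indicator {t1<..} t) \<in> Linf"
      and 2: "EL_apply \<gamma> f2 = \<gamma> (\<lambda>t. f2 t * indicator {t2<..} t)" "(\<lambda>t. f2 t * indicator {t2<..} t) \<in> Linf"
      and 3: "EL_apply \<gamma> f3 = \<gamma> (\<lambda>t. f3 t * indicator {t3<..} t)" "(\<lambda>t. f3 t * indicator {t3<..} t) \<in> Linf"
    using *[OF Linf(1)] *[OF Linf(2)] *[OF Linf(3)] by blast
  let ?d = "\<lambda>t. f1 t * indicator {t1<..} t - f2 t * indicator {t2<..} t - f3 t * indicator {t3<..} t"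
  have "eventually (\<lambda>t. f1 t - f2 t - f3 t = ?d t) at_top"
    using eventually_gt_at_top[of t1] eventually_gt_at_top[of t2] eventually_gt_at_top[of t3]
    by eventually_elim simp
  with lim have "(?d \<longlongrightarrow> 0) at_top"
    by (rule Lim_transform_eventually)
  then have "has_ess_lim ?d 0"
    by (rule has_ess_limI)
  moreover have "?d \<in> Linf"
    by (intro Linf_diff 1 2 3)
  moreover have "\<forall>f\<in>Linf. \<forall>c. has_ess_lim f c \<longrightarrow> \<gamma> f = c"
    using \<gamma> unfolding EL_def mem_Collect_eq by (elim conjE)
  ultimately have "\<gamma> ?d = 0"
    by blast
  moreover have "\<gamma> ?d = EL_apply \<gamma> f1 - EL_apply \<gamma> f2 - EL_apply \<gamma> f3"
    using 1 2 3 by (simp add: EL_diff[OF \<gamma>] Linf_diff)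
  ultimately show ?thesis
    by simp
qed

section \<open>The residue of the operators D(x)\<close>

context dyadic_density
begin

definition dirichlet_mean :: "(nat \<Rightarrow> real) \<Rightarrow> real \<Rightarrow> real" where
  "dirichlet_mean x t = 1 / phi t * (\<Sum>n. x n * 2 powr (- real n / t) * 2 ^ n * g (2 ^ n))"

text \<open>
  The trace of the power \<open>1 + 1/t\<close> of \<open>D(y)\<close>, summed block by block. It is extended valued because it
  may be infinite for small \<open>t\<close>.
\<close>
definition dyadic_trace :: "(nat \<Rightarrow> real) \<Rightarrow> real \<Rightarrow> ennreal" where
  "dyadic_trace y t = (\<Sum>n. ennreal (2 ^ n * (y n * g (2 ^ n)) powr (1 + 1 / t)))"

lemma suminf_mass_exp_le_phi:
  "\<exists>C t0. 0 < C \<and> 0 < t0 \<and> (\<forall>t\<ge>t0. summable (\<lambda>n. mass n * exp (- real n / (4 * t))) \<and>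
      (\<Sum>n. mass n * exp (- real n / (4 * t))) \<le> C * phi t)"
proof -
  obtain C t0 where C: "0 < C" "0 < t0"
    "\<And>t M. t \<ge> t0 \<Longrightarrow> (\<Sum>n<M. mass n * exp (- real n / (4 * t))) \<le> C * phi t"
    using sum_mass_exp_le_phi by blast
  have pos: "0 \<le> mass n * exp (- real n / (4 * t))" for n t
    using mass_pos[of n] by simp
  have "summable (\<lambda>n. mass n * exp (- real n / (4 * t)))" if "t \<ge> t0" for t
    by (rule summableI_nonneg_bounded[OF pos C(3)[OF that]])
  with C show ?thesis
    by (intro exI[of _ C] exI[of _ t0]) (auto intro: suminf_le_const)
qed

lemma dirichlet_term_le:
  assumes "\<bar>x n\<bar> \<le> B" "t > 0"
  shows "\<bar>x n * 2 powr (- real n / t) * 2 ^ n * g (2 ^ n)\<bar> \<le> B * (mass n * exp (- real n / (4 * t)))"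
proof -
  have "2 powr (- real n / t) \<le> exp (- real n / (4 * t))"
    using two_powr_times_exp_le(1)[of "real n / t" 0] assms by (simp add: mult.commute)
  then have "\<bar>x n\<bar> * (2 powr (- real n / t) * mass n) \<le> B * (exp (- real n / (4 * t)) * mass n)"
    using assms mass_pos[of n] by (intro mult_mono) auto
  then show ?thesis
    using g_pos[of "2 ^ n"] by (simp add: abs_mult mass_def mult_ac)
qed

lemma
  assumes "\<And>n. \<bar>x n\<bar> \<le> B"
  shows eventually_summable_dirichlet:
      "eventually (\<lambda>t. summable (\<lambda>n. x n * 2 powr (- real n / t) * 2 ^ n * g (2 ^ n))) at_top"
    and dirichlet_mean_bounded: "\<exists>C. eventually (\<lambda>t. \<bar>dirichlet_mean x t\<bar> \<le> C) at_top"
proof -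
  obtain C t0 where C: "0 < C" "0 < t0"
    and sm: "\<And>t. t \<ge> t0 \<Longrightarrow> summable (\<lambda>n. mass n * exp (- real n / (4 * t)))"
    and le: "\<And>t. t \<ge> t0 \<Longrightarrow> (\<Sum>n. mass n * exp (- real n / (4 * t))) \<le> C * phi t"
    using suminf_mass_exp_le_phi by blast
  have B: "B \<ge> 0"
    using assms[of 0] by simp
  have *: "summable (\<lambda>n. x n * 2 powr (- real n / t) * 2 ^ n * g (2 ^ n)) \<and> \<bar>dirichlet_mean x t\<bar> \<le> B * C"
    if t: "t \<ge> t0" for t
  proof -
    have bound: "norm (x n * 2 powr (- real n / t) * 2 ^ n * g (2 ^ n)) \<le> B * (mass n * exp (- real n / (4 * t)))" for n
      using dirichlet_term_le[of x n B t] assms t C by simp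
    have sm': "summable (\<lambda>n. B * (mass n * exp (- real n / (4 * t))))"
      by (intro summable_mult sm t)
    have "\<bar>\<Sum>n. x n * 2 powr (- real n / t) * 2 ^ n * g (2 ^ n)\<bar> \<le> (\<Sum>n. B * (mass n * exp (- real n / (4 * t))))"
      using norm_suminf_le[OF bound sm'] by simp
    also have "\<dots> = B * (\<Sum>n. mass n * exp (- real n / (4 * t)))"
      by (rule suminf_mult[OF sm[OF t]])
    also have "\<dots> \<le> B * (C * phi t)"
      using B by (intro mult_left_mono le t)
    finally have "\<bar>dirichlet_mean x t\<bar> \<le> 1 / phi t * (B * (C * phi t))"
      using phi_pos[of t] t C unfolding dirichlet_mean_def abs_mult by (intro mult_mono) auto
    moreover have "summable (\<lambda>n. x n * 2 powr (- real n / t) * 2 ^ n * g (2 ^ n))"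
      by (rule summable_comparison_test'[OF sm', of 0]) (rule bound)
    ultimately show ?thesis
      using phi_pos[of t] t C by simp
  qed
  then show "eventually (\<lambda>t. summable (\<lambda>n. x n * 2 powr (- real n / t) * 2 ^ n * g (2 ^ n))) at_top"
    "\<exists>C. eventually (\<lambda>t. \<bar>dirichlet_mean x t\<bar> \<le> C) at_top"
    unfolding eventually_at_top_linorder by blast+
qed

text \<open>
  Summing the termwise estimate costs a factor \<open>O(phi t)\<close>, which the normalization removes.
\<close>
lemma
  assumes "\<And>n. 0 \<le> y n" "\<And>n. y n \<le> B"
  shows dyadic_trace_finite: "eventually (\<lambda>t. dyadic_trace y t < top) at_top"
    and dyadic_trace_approx: "((\<lambda>t. 1 / phi t * enn2real (dyadic_trace y t) - dirichlet_mean y t) \<longlongrightarrow> 0) at_top"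
proof -
  obtain C t0 where C: "0 < C" "0 < t0"
    and sm: "\<And>t. t \<ge> t0 \<Longrightarrow> summable (\<lambda>n. mass n * exp (- real n / (4 * t)))"
    and le: "\<And>t. t \<ge> t0 \<Longrightarrow> (\<Sum>n. mass n * exp (- real n / (4 * t))) \<le> C * phi t"
    using suminf_mass_exp_le_phi by blast
  have abs_y: "\<bar>y n\<bar> \<le> B" for n
    using assms by simp
  have *: "eventually (\<lambda>t. dyadic_trace y t < top \<and>
      \<bar>1 / phi t * enn2real (dyadic_trace y t) - dirichlet_mean y t\<bar> \<le> \<eta>) at_top" if "\<eta> > 0" for \<eta>
  proof -
    have "eventually (\<lambda>t. \<forall>n z. 0 \<le> z \<longrightarrow> z \<le> max 1 B \<longrightarrow>
      \<bar>2 ^ n * (z * g (2 ^ n)) powr (1 + 1 / t) - z * 2 powr (- real n / t) * 2 ^ n * g (2 ^ n)\<bar>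
      \<le> \<eta> / C * (mass n * exp (- real n / (4 * t)))) at_top"
      using that C by (intro trace_term_approx) auto
    moreover note eventually_summable_dirichlet[of y B, OF abs_y] eventually_ge_at_top[of t0]
    ultimately show ?thesis
    proof eventually_elim
      case (elim t)
      let ?p = "\<lambda>n. 2 ^ n * (y n * g (2 ^ n)) powr (1 + 1 / t)"
      let ?q = "\<lambda>n. y n * 2 powr (- real n / t) * 2 ^ n * g (2 ^ n)"
      let ?W = "\<lambda>n. \<eta> / C * (mass n * exp (- real n / (4 * t)))"
      have bound: "norm (?p n - ?q n) \<le> ?W n" for n
        using elim(1) assms by (simp add: le_max_iff_disj)
      have smW: "summable ?W"
        by (intro summable_mult sm elim)
      have smd: "summable (\<lambda>n. ?p n - ?q n)"
        by (rule summable_comparison_test'[OF smW, of 0]) (rule bound)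
      have "summable (\<lambda>n. (?p n - ?q n) + ?q n)"
        by (intro summable_add smd elim)
      then have smp: "summable ?p"
        by simp
      have tr: "dyadic_trace y t = ennreal (\<Sum>n. ?p n)"
        unfolding dyadic_trace_def by (intro suminf_ennreal2 smp) auto
      have "\<bar>(\<Sum>n. ?p n) - (\<Sum>n. ?q n)\<bar> = \<bar>\<Sum>n. ?p n - ?q n\<bar>"
        by (subst suminf_diff[OF smp elim(2)]) simp
      also have "\<dots> \<le> (\<Sum>n. ?W n)"
        using norm_suminf_le[OF bound smW] by simp
      also have "\<dots> = \<eta> / C * (\<Sum>n. mass n * exp (- real n / (4 * t)))"
        by (rule suminf_mult[OF sm[OF elim(3)]])
      also have "\<dots> \<le> \<eta> / C * (C * phi t)"
        using that C by (intro mult_left_mono le elim) auto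
      also have "\<dots> = \<eta> * phi t"
        using C by simp
      finally have "\<bar>(\<Sum>n. ?p n) - (\<Sum>n. ?q n)\<bar> \<le> \<eta> * phi t" .
      moreover have "phi t > 0"
        using elim C by (intro phi_pos) simp
      moreover have "1 / phi t * enn2real (dyadic_trace y t) - dirichlet_mean y t
          = ((\<Sum>n. ?p n) - (\<Sum>n. ?q n)) / phi t"
        unfolding tr dirichlet_mean_def
        by (simp add: suminf_nonneg[OF smp] diff_divide_distrib)
      ultimately show ?case
        by (simp add: tr field_simps abs_mult)
    qed
  qed
  show "eventually (\<lambda>t. dyadic_trace y t < top) at_top"
    using *[of 1] by (auto elim: eventually_mono)
  show "((\<lambda>t. 1 / phi t * enn2real (dyadic_trace y t) - dirichlet_mean y t) \<longlongrightarrow> 0) at_top"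
  proof (rule tendstoI)
    fix \<eta> :: real assume "\<eta> > 0"
    then show "eventually (\<lambda>t. dist (1 / phi t * enn2real (dyadic_trace y t) - dirichlet_mean y t) 0 < \<eta>) at_top"
      using *[of "\<eta> / 2"] by (auto elim!: eventually_mono)
  qed
qed

lemma phi_measurable [measurable]: "phi \<in> borel_measurable borel"
  by (rule borel_measurable_mono) (auto simp: mono_def intro: phi_mono)

lemma eventually_Linf_dirichlet_mean:
  assumes "\<And>n. \<bar>x n\<bar> \<le> B"
  shows "eventually_Linf (dirichlet_mean x)"
proof -
  obtain C where "eventually (\<lambda>t. \<bar>dirichlet_mean x t\<bar> \<le> C) at_top"
    using dirichlet_mean_bounded[of x B, OF assms] by blast
  moreover have "dirichlet_mean x \<in> borel_measurable borel"
    unfolding dirichlet_mean_def[abs_def] by measurable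
  ultimately show ?thesis
    by (intro eventually_LinfI)
qed

lemma dyadic_trace_bounded:
  assumes "\<And>n. 0 \<le> y n" "\<And>n. y n \<le> B"
  shows "\<exists>C. eventually (\<lambda>t. \<bar>1 / phi t * enn2real (dyadic_trace y t)\<bar> \<le> C) at_top"
proof -
  have abs_y: "\<bar>y n\<bar> \<le> B" for n
    using assms by simp
  obtain C where "eventually (\<lambda>t. \<bar>dirichlet_mean y t\<bar> \<le> C) at_top"
    using dirichlet_mean_bounded[of y B, OF abs_y] by blast
  moreover have "eventually (\<lambda>t. dist (1 / phi t * enn2real (dyadic_trace y t) - dirichlet_mean y t) 0 < 1) at_top"
    by (rule tendstoD[OF dyadic_trace_approx[of y B, OF assms]]) simp
  ultimately have "eventually (\<lambda>t. \<bar>1 / phi t * enn2real (dyadic_trace y t)\<bar> \<le> C + 1) at_top"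
    by eventually_elim (simp add: dist_real_def)
  then show ?thesis
    by blast
qed

lemma eventually_Linf_dyadic_trace:
  assumes "\<And>n. 0 \<le> y n" "\<And>n. y n \<le> B"
  shows "eventually_Linf (\<lambda>t. 1 / phi t * enn2real (dyadic_trace y t))"
proof -
  have "(\<lambda>t. 1 / phi t * enn2real (dyadic_trace y t)) \<in> borel_measurable borel"
    unfolding dyadic_trace_def by measurable
  then show ?thesis
    using dyadic_trace_bounded[of y B, OF assms] eventually_LinfI by blast
qed

end

locale zeta_setting = onb e + dyadic_density g L
  for e :: "nat \<Rightarrow> 'h::chilbert_space" and g :: "real \<Rightarrow> real" and L :: real
begin

lemma D_op_weights_tendsto_0:
  assumes "\<And>n. \<bar>x n\<bar> \<le> B"
  shows "(\<lambda>k. x (dyadic_level k) * g (2 ^ dyadic_level k)) \<longlonglongrightarrow> 0"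
proof -
  have "filterlim (\<lambda>n. (2::real) ^ n) at_top sequentially"
    by (intro filterlim_at_infinity_imp_filterlim_at_top filterlim_realpow_sequentially_gt1) auto
  then have "(\<lambda>n. g (2 ^ n)) \<longlonglongrightarrow> 0"
    by (rule filterlim_compose[OF g_tendsto_0])
  moreover have "eventually (\<lambda>n. norm (x n) \<le> B) sequentially"
    using assms by simp
  ultimately have "(\<lambda>n. x n * g (2 ^ n)) \<longlonglongrightarrow> 0"
    by (rule lim_null_mult_left_bounded[rotated])
  then show ?thesis
    by (rule filterlim_compose[OF _ filterlim_dyadic_level])
qed

lemma bounded_D_op_weights:
  assumes "\<And>n. \<bar>x n\<bar> \<le> B"
  shows "bounded (range (\<lambda>k. x (dyadic_level k) * g (2 ^ dyadic_level k)))"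
  using D_op_weights_tendsto_0[of x B, OF assms] convergent_imp_bounded by blast

lemma Tr_powr_op_D_op:
  assumes "\<And>n. 0 \<le> y n" "\<And>n. y n \<le> B" "t > 0"
  shows "Tr e (powr_op (D_op e g y) (1 + 1 / t)) = dyadic_trace y t"
proof -
  have abs_y: "\<bar>y n\<bar> \<le> B" for n
    using assms by simp
  have "Tr e (powr_op (D_op e g y) (1 + 1 / t)) =
      (\<Sum>k. ennreal ((y (dyadic_level k) * g (2 ^ dyadic_level k)) powr (1 + 1 / t)))"
    unfolding D_op_def
  proof (rule Tr_powr_op_diag_op)
    show "0 \<le> y (dyadic_level k) * g (2 ^ dyadic_level k)" for k
      using assms g_pos[of "2 ^ dyadic_level k"] by simp
    show "bounded (range (\<lambda>k. y (dyadic_level k) * g (2 ^ dyadic_level k)))"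
      using abs_y by (rule bounded_D_op_weights)
  qed (use assms in simp)
  also have "\<dots> = (\<Sum>n. 2 ^ n * ennreal ((y n * g (2 ^ n)) powr (1 + 1 / t)))"
    by (rule suminf_dyadic_level)
  also have "\<dots> = dyadic_trace y t"
    unfolding dyadic_trace_def by (simp add: ennreal_mult ennreal_power[symmetric])
  finally show ?thesis .
qed

text \<open>
  The absolute value of \<open>D(x)\<close> is \<open>D(|x|)\<close>, whose normalized trace is bounded for large \<open>t\<close>.
\<close>
lemma D_op_class_Z:
  assumes "\<And>n. \<bar>x n\<bar> \<le> B"
  shows "D_op e g x \<in> class_Z e (primitive g)"
proof -
  have abs: "abs_op (D_op e g x) = D_op e g (\<lambda>n. \<bar>x n\<bar>)"
    unfolding D_op_def abs_op_diag_op[OF bounded_D_op_weights[of x B, OF assms]]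
    by (simp add: abs_mult abs_of_pos[OF g_pos])
  obtain C where C: "eventually (\<lambda>t. \<bar>1 / phi t * enn2real (dyadic_trace (\<lambda>n. \<bar>x n\<bar>) t)\<bar> \<le> C) at_top"
    using dyadic_trace_bounded[of "\<lambda>n. \<bar>x n\<bar>" B] assms by auto
  have fin: "eventually (\<lambda>t. dyadic_trace (\<lambda>n. \<bar>x n\<bar>) t < top) at_top"
    using dyadic_trace_finite[of "\<lambda>n. \<bar>x n\<bar>" B] assms by auto
  have "eventually (\<lambda>t. Tr e (powr_op (abs_op (D_op e g x)) (1 + 1 / t)) / ennreal (primitive g (exp t)) \<le> ennreal C) at_top"
    using C fin eventually_gt_at_top[of 0]
  proof eventually_elim
    case (elim t)
    define r where "r = enn2real (dyadic_trace (\<lambda>n. \<bar>x n\<bar>) t)"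
    have r: "dyadic_trace (\<lambda>n. \<bar>x n\<bar>) t = ennreal r" "r \<ge> 0"
      using elim(2) by (auto simp: r_def)
    have "phi t > 0"
      using elim by (intro phi_pos) simp
    then have "r / phi t \<le> C"
      using elim(1) r(2) by (simp add: r_def[symmetric])
    moreover have "Tr e (powr_op (abs_op (D_op e g x)) (1 + 1 / t)) = ennreal r"
      unfolding abs r(1)[symmetric] using assms elim by (intro Tr_powr_op_D_op[where B = B]) auto
    ultimately show ?case
      using r(2) \<open>phi t > 0\<close> by (simp add: phi_def[symmetric] divide_ennreal ennreal_leI)
  qed
  then have "Limsup at_top (\<lambda>t. Tr e (powr_op (abs_op (D_op e g x)) (1 + 1 / t)) / ennreal (primitive g (exp t))) \<le> ennreal C"
    by (rule Limsup_bounded)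
  also have "\<dots> < \<infinity>"
    by simp
  finally show ?thesis
    unfolding class_Z_def
    using compact_diag_op[OF D_op_weights_tendsto_0[of x B, OF assms]] by (simp add: D_op_def)
qed

lemma zeta_pos_integrand:
  assumes "\<And>n. 0 \<le> y n" "\<And>n. y n \<le> B"
  defines "F \<equiv> (\<lambda>t. 1 / primitive g (exp t) * enn2real (Tr e (powr_op (D_op e g y) (1 + 1 / t))))"
  shows "eventually_Linf F" and "((\<lambda>t. F t - dirichlet_mean y t) \<longlongrightarrow> 0) at_top"
proof -
  have eq: "1 / phi t * enn2real (dyadic_trace y t) = F t" if "t > 0" for t
    using Tr_powr_op_D_op[of y B t] assms(1,2) that by (simp add: F_def phi_def)
  show "eventually_Linf F"
    by (rule eventually_Linf_cong[OF eventually_Linf_dyadic_trace[of y B]]) (use assms(1,2) eq in auto)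
  have "eventually (\<lambda>t. 1 / phi t * enn2real (dyadic_trace y t) - dirichlet_mean y t = F t - dirichlet_mean y t) at_top"
    using eventually_gt_at_top[of 0] by eventually_elim (simp only: eq)
  with dyadic_trace_approx[of y B, OF assms(1,2)]
  show "((\<lambda>t. F t - dirichlet_mean y t) \<longlongrightarrow> 0) at_top"
    by (rule Lim_transform_eventually)
qed

text \<open>
  The operator is self-adjoint, so the imaginary part contributes nothing. For the real part, the
  normalized traces of \<open>D(x\<^sup>+)\<close> and \<open>D(x\<^sup>-)\<close> differ by null functions from the Dirichlet means of \<open>x\<^sup>+\<close> and \<open>x\<^sup>-\<close>,
  and the difference of these is the mean of \<open>x\<close> as soon as both series converge.
\<close>
lemma zeta_D_op:
  assumes "\<gamma> \<in> EL" "\<And>n. \<bar>x n\<bar> \<le> B"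
  shows "zeta \<gamma> e (primitive g) (D_op e g x) = complex_of_real (EL_apply \<gamma> (dirichlet_mean x))"
proof -
  define xp where "xp = (\<lambda>n. max (x n) 0)"
  define xm where "xm = (\<lambda>n. max (- x n) 0)"
  have "B \<ge> 0"
    using assms(2)[of 0] by simp
  have xp: "\<And>n. 0 \<le> xp n" "\<And>n. xp n \<le> B" and xm: "\<And>n. 0 \<le> xm n" "\<And>n. xm n \<le> B"
    using assms(2) \<open>B \<ge> 0\<close> by (auto simp: xp_def xm_def abs_le_iff minus_le_iff)
  note bd = bounded_D_op_weights[of x B, OF assms(2)]
  have max_mult: "max (a * g (2 ^ n)) 0 = max a 0 * g (2 ^ n)" for a and n :: nat
    using g_pos[of "2 ^ n"] by (simp add: max_mult_distrib_right)
  have pos: "pos_part (D_op e g x) = D_op e g xp"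
    unfolding D_op_def pos_part_diag_op[OF bd] xp_def by (simp add: max_mult)
  have neg: "neg_part (D_op e g x) = D_op e g xm"
    unfolding D_op_def neg_part_diag_op[OF bd] xm_def by (simp only: mult_minus_left[symmetric] max_mult)
  have Re: "Re_op (D_op e g x) = D_op e g x"
    unfolding D_op_def by (rule Re_op_diag_op[OF bd])
  have Im: "Im_op (D_op e g x) = D_op e g (\<lambda>_. 0)"
    unfolding D_op_def by (simp add: Im_op_diag_op[OF bd])
  have pos0: "pos_part (D_op e g (\<lambda>_. 0)) = D_op e g (\<lambda>_. 0)"
    and neg0: "neg_part (D_op e g (\<lambda>_. 0)) = D_op e g (\<lambda>_. 0)"
    unfolding D_op_def by (simp_all add: pos_part_diag_op neg_part_diag_op)
  have main: "zeta_pos \<gamma> e (primitive g) (D_op e g xp) - zeta_pos \<gamma> e (primitive g) (D_op e g xm)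
       = EL_apply \<gamma> (dirichlet_mean x)"
    unfolding zeta_pos_def
  proof (rule EL_apply_diff_eqI[OF assms(1)])
    note P = zeta_pos_integrand[of xp B, OF xp] and M = zeta_pos_integrand[of xm B, OF xm]
    show "eventually_Linf (\<lambda>t. 1 / primitive g (exp t) * enn2real (Tr e (powr_op (D_op e g xp) (1 + 1 / t))))"
      "eventually_Linf (\<lambda>t. 1 / primitive g (exp t) * enn2real (Tr e (powr_op (D_op e g xm) (1 + 1 / t))))"
      by (fact P(1) M(1))+
    show "eventually_Linf (dirichlet_mean x)"
      using assms(2) by (rule eventually_Linf_dirichlet_mean)
    have sm: "eventually (\<lambda>t. summable (\<lambda>n. y n * 2 powr (- real n / t) * 2 ^ n * g (2 ^ n))) at_top"
      if "\<And>n. 0 \<le> y n" "\<And>n. y n \<le> B" for y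
      by (rule eventually_summable_dirichlet[of y B]) (use that in auto)
    have "eventually (\<lambda>t. dirichlet_mean x t = dirichlet_mean xp t - dirichlet_mean xm t) at_top"
      using sm[of xp, OF xp] sm[of xm, OF xm]
    proof eventually_elim
      case (elim t)
      have "x n = xp n - xm n" for n
        by (simp add: xp_def xm_def)
      then show ?case
        unfolding dirichlet_mean_def right_diff_distrib[symmetric] suminf_diff[OF elim]
        by (simp add: left_diff_distrib)
    qed
    then have ev: "eventually (\<lambda>t. (F t - dirichlet_mean xp t) - (F' t - dirichlet_mean xm t)
       = F t - F' t - dirichlet_mean x t) at_top" for F F' :: "real \<Rightarrow> real"
      by eventually_elim simp
    show "((\<lambda>t. 1 / primitive g (exp t) * enn2real (Tr e (powr_op (D_op e g xp) (1 + 1 / t))) -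
      1 / primitive g (exp t) * enn2real (Tr e (powr_op (D_op e g xm) (1 + 1 / t))) - dirichlet_mean x t) \<longlongrightarrow> 0) at_top"
      by (rule Lim_transform_eventually[OF _ ev]) (use tendsto_diff[OF P(2) M(2)] in simp)
  qed
  have "zeta \<gamma> e (primitive g) (D_op e g x) = complex_of_real
      (zeta_pos \<gamma> e (primitive g) (D_op e g xp) - zeta_pos \<gamma> e (primitive g) (D_op e g xm))"
    using D_op_class_Z[of x B, OF assms(2)] by (simp add: zeta_def Re Im pos neg pos0 neg0)
  then show ?thesis
    unfolding main .
qed

end

theorem theorem4p5:
  fixes e :: "nat \<Rightarrow> 'h::chilbert_space"
    and g :: "real \<Rightarrow> real" and \<alpha> :: real
    and \<gamma> :: "(real \<Rightarrow> real) \<Rightarrow> real"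
    and x :: "nat \<Rightarrow> real"
  assumes "orthonormal_basis e"
    and "g \<in> class_G"
    and "\<alpha> \<ge> 0"
    and "\<And>r::real. r > 0 \<Longrightarrow>
           ((\<lambda>t. primitive g (t powr r) / primitive g t) \<longlongrightarrow> r powr \<alpha>) at_top"
    and "eventually_monotone (\<lambda>t. t * g t)"
    and "\<gamma> \<in> EL"
    and "bounded (range x)"
  shows "B_functional \<gamma> e g \<alpha> x =
    complex_of_real (ln 2 / Gamma (\<alpha> + 1) *
      EL_apply \<gamma> (\<lambda>t. 1 / primitive g (exp t) *
        (\<Sum>n. x n * 2 powr (- real n / t) * 2 ^ n * g (2 ^ n))))"
proof -
  interpret zeta_setting e g "2 powr \<alpha>"
    by unfold_locales (use assms(1,2) assms(4)[of 2] in auto)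
  obtain B where "\<And>n. \<bar>x n\<bar> \<le> B"
    using assms(7) by (auto simp: bounded_iff)
  with assms(6) have "zeta \<gamma> e (primitive g) (D_op e g x) = complex_of_real (EL_apply \<gamma> (dirichlet_mean x))"
    by (rule zeta_D_op)
  then show ?thesis
    by (simp add: B_functional_def dirichlet_mean_def[abs_def] phi_def)
qed

end
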